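(* Consider the semi-discrete (continuous in time) curvilinear split-form DGSEM for the resistive GLM-MHD equations (scheme written out in the context) on a conforming, fully periodic mesh of curved hexahedral elements with positive nodal Jacobians and with metric terms satisfying the discrete metric identities. Choose $$(\boldsymbol\Phi^{\mathrm{GLM}}_n\psi)^\Diamond=\Big(\sum_{\ell}n_\ell(\boldsymbol\Phi^{\mathrm{GLM}}_\ell)^-\Big)\{\!\{\psi\}\!\},\qquad (\boldsymbol\Phi^{\mathrm{MHD}}B_n)^\Diamond=(\boldsymbol\Phi^{\mathrm{MHD}})^-\,\{\!\{\vec B\}\!\}\cdot\vec n,$$ take both the two-point volume fluxes and the surface fluxes to be the entropy conservative flux, $\mathbf F^{a,\#}=\mathbf F^{\mathrm{EC}}$ and $\mathbf F^{a,*}_n=\mathbf F^{\mathrm{EC}}\cdot\vec n$, and take the viscous interface fluxes (BR1) $$\mathbf F^{v,*}_n=\{\!\{\mathbf F^v\}\!\}\cdot\vec n,\qquad \mathbf W^*=\{\!\{\mathbf W\}\!\}.$$ Then the scheme is entropy stable: for every solution with nodal values satisfying $\rho,p>0$, the discrete total entropy $\overline S=\sum_{\nu=1}^{N_{\mathrm{el}}}\sum_{i,j,k=0}^N\omega_{ijk}J^\nu_{ijk}S(\mathbf U^\nu_{ijk})$ satisfies $$\frac{d\overline S}{dt}\le0 .$$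
   Context: **Continuous quantities.** State $\mathbf u=(\rho,\rho\vec v,E,\vec B,\psi)^T\in\mathbb R^9$; $p=(\gamma-1)(E-\tfrac12\rho\|\vec v\|^2-\tfrac12\|\vec B\|^2-\tfrac12\psi^2)$, $\gamma>1$; constants $\mu_{\mathrm{NS}},\mu_{\mathrm R},\kappa,R>0$, $\alpha\ge0$, GLM speed $c_h$. Entropy $S=-\frac{\rho s}{\gamma-1}$, $s=\ln(p\rho^{-\gamma})$; entropy variables $\mathbf w=\partial S/\partial\mathbf u=\big(\tfrac{\gamma-s}{\gamma-1}-\beta\|\vec v\|^2,2\beta\vec v,-2\beta,2\beta\vec B,2\beta\psi\big)^T$, $\beta=\frac\rho{2p}$. Advective flux in direction $\ell=1,2,3$ (mass; momentum $k$; energy; magnetic $k$; $\psi$): $\mathbf f^a_\ell=\big(\rho v_\ell;\ \rho v_\ell v_k+(p+\tfrac12\|\vec B\|^2)\delta_{\ell k}-B_\ell B_k;\ v_\ell(\tfrac12\rho\|\vec v\|^2+\tfrac{\gamma p}{\gamma-1}+\|\vec B\|^2)-B_\ell(\vec v\cdot\vec B)+c_h\psi B_\ell;\ v_\ell B_k-B_\ell v_k+c_h\psi\delta_{\ell k};\ c_hB_\ell\big)$. Viscous flux: $\mathbf f^v_\ell(\mathbf u,\vec\nabla\mathbf u)=\big(0;\ \tau_{\ell k};\ \sum_k\tau_{\ell k}v_k+\kappa\partial_\ell(\tfrac p{R\rho})-\mu_{\mathrm R}((\vec\nabla\times\vec B)\times\vec B)_\ell;\ \mu_{\mathrm R}(\partial_\ell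 B_k-\partial_kB_\ell);\ 0\big)$ with $\tau_{\ell k}=\mu_{\mathrm{NS}}(\partial_\ell v_k+\partial_kv_\ell)-\tfrac23\mu_{\mathrm{NS}}(\vec\nabla\cdot\vec v)\delta_{\ell k}$; it is linear in $\vec\nabla\mathbf u$. Non-conservative vectors: $\boldsymbol\Phi^{\mathrm{MHD}}=(0,B_1,B_2,B_3,\vec v\cdot\vec B,v_1,v_2,v_3,0)^T$, $\boldsymbol\Phi^{\mathrm{GLM}}_\ell=(0,0,0,0,v_\ell\psi,0,0,0,v_\ell)^T$. Damping: $\mathbf R=(0,\dots,0,-\alpha\psi)^T$. **Entropy conservative flux.** For two states $L,R$: $\{\!\{a\}\!\}=\tfrac12(a_L+a_R)$, $[\![a]\!]=a_R-a_L$, $a^{\ln}=[\![a]\!]/[\![\ln a]\!]$ (equal to $a$ if $a_L=a_R=a$), $\overline p=\{\!\{\rho\}\!\}/(2\{\!\{\beta\}\!\})$. $\mathbf F^{\mathrm{EC}}=(\mathbf F^{\mathrm{EC}}_1,\mathbf F^{\mathrm{EC}}_2,\mathbf F^{\mathrm{EC}}_3)$, where $\mathbf F^{\mathrm{EC}}_\ell$ has mass component $F_\rho=\rho^{\ln}\{\!\{v_\ell\}\!\}$; momentum components $F_{m_k}=\rho^{\ln}\{\!\{v_\ell\}\!\}\{\!\{v_k\}\!\}-\{\!\{B_\ell\}\!\}\{\!\{B_k\}\!\}+\delta_{\ell k}\big(\overline p+\tfrac12\sum_{q=1}^3\{\!\{B_q^2\}\!\}\big)$; magnetic components $F_{B_k}=\{\!\{v_\ell\}\!\}\{\!\{B_k\}\!\}-\{\!\{v_k\}\!\}\{\!\{B_\ell\}\!\}+\delta_{\ell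 k}c_h\{\!\{\psi\}\!\}$; $\psi$-component $F_\psi=c_h\{\!\{B_\ell\}\!\}$; energy component $F_E=F_\rho\big[\tfrac1{2(\gamma-1)\beta^{\ln}}-\tfrac12\sum_k\{\!\{v_k^2\}\!\}\big]+\sum_kF_{m_k}\{\!\{v_k\}\!\}+\sum_kF_{B_k}\{\!\{B_k\}\!\}+F_\psi\{\!\{\psi\}\!\}-\tfrac12\sum_k\{\!\{v_\ell B_k^2\}\!\}+\{\!\{B_\ell\}\!\}\sum_k\{\!\{v_kB_k\}\!\}-c_h\{\!\{B_\ell\psi\}\!\}$. **Element discretization.** Let $\xi_0,\dots,\xi_N$ and $\omega_0,\dots,\omega_N$ be Legendre–Gauss–Lobatto (LGL) nodes and weights on $[-1,1]$ ($N\ge1$), $\ell_j$ the Lagrange basis, $\mathcal D_{im}=\ell_m'(\xi_i)$, $\omega_{ijk}=\omega_i\omega_j\omega_k$. Each element $E_\nu$, $\nu=1,\dots,N_{\mathrm{el}}$, is mapped from the reference cube $E=[-1,1]^3$ with coordinates $(\xi^1,\xi^2,\xi^3)=(\xi,\eta,\zeta)$. It carries nodal Jacobians $J_{ijk}>0$ and nodal (volume-weighted contravariant) metric vectors $J\vec a^{\,1},J\vec a^{\,2},J\vec a^{\,3}\in\mathbb R^3$ with components $Ja^i_n$; $\mathbb I^N$ denotes tensor-product interpolation at the LGL nodes. Discrete metric identities: $\sum_{i=1}^3\partial_{\xi^i}\mathbb I^N(Ja^i_n)=0$, $n=1,2,3$ (ensured by computing the metric terms in curl form). On the face $\xi^i=\pm1$,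 $\hat s\,\vec n=\pm J\vec a^{\,i}$, $\hat s=|J\vec a^{\,i}|$, $\vec n$ being the outward unit normal. Discrete inner product: $\langle f,g\rangle_N=\sum_{i,j,k}\omega_{ijk}f_{ijk}^Tg_{ijk}$ (summed over the three blocks for block vectors). Discrete surface integral $\int_{\partial E,N}g\,\hat s\,\mathrm dS$: sum over the six faces of the tensor LGL quadrature of $g\hat s$. For $\mathbf G=(\mathbf G_1,\mathbf G_2,\mathbf G_3)$ and $\vec c\in\mathbb R^3$, $\mathbf G\cdot\vec c=\sum_\ell c_\ell\mathbf G_\ell$; subscript $n$ denotes contraction with $\vec n$; $B_n=\vec B\cdot\vec n$. $\{\!\{\cdot\}\!\}_{(i,m)jk}$ is the mean of values at nodes $ijk$ and $mjk$, and similarly in the other directions. At each node $ijk$ define - $\mathbb D\cdot\tilde{\mathbf F}^{a,\#}=2\sum_m\mathcal D_{im}\mathbf F^{a,\#}(\mathbf U_{ijk},\mathbf U_{mjk})\cdot\{\!\{J\vec a^{\,1}\}\!\}_{(i,m)jk}+2\sum_m\mathcal D_{jm}\mathbf F^{a,\#}(\mathbf U_{ijk},\mathbf U_{imk})\cdot\{\!\{J\vec a^{\,2}\}\!\}_{i(j,m)k}+2\sum_m\mathcal D_{km}\mathbf F^{a,\#}(\mathbf U_{ijk},\mathbf U_{ijm})\cdot\{\!\{J\vec a^{\,3}\}\!\}_{ij(k,m)}$; - $\boldsymbol\Phi^{\mathrm{MHD}}\mathbb D^{\mathrm{NC}}_{\mathrm{div}}\cdot\tilde B=\boldsymbol\Phi^{\mathrm{MHD}}_{ijk}\sum_m\big(\mathcal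 D_{im}\vec B_{mjk}\cdot\{\!\{J\vec a^{\,1}\}\!\}_{(i,m)jk}+\mathcal D_{jm}\vec B_{imk}\cdot\{\!\{J\vec a^{\,2}\}\!\}_{i(j,m)k}+\mathcal D_{km}\vec B_{ijm}\cdot\{\!\{J\vec a^{\,3}\}\!\}_{ij(k,m)}\big)$; - $\tilde{\boldsymbol\Phi}^{\mathrm{GLM}}\cdot\mathbb D^{\mathrm{NC}}_{\mathrm{grad}}\psi=\sum_m\big(\mathcal D_{im}(\boldsymbol\Phi^{\mathrm{GLM}}\cdot J\vec a^{\,1})_{ijk}\psi_{mjk}+\mathcal D_{jm}(\boldsymbol\Phi^{\mathrm{GLM}}\cdot J\vec a^{\,2})_{ijk}\psi_{imk}+\mathcal D_{km}(\boldsymbol\Phi^{\mathrm{GLM}}\cdot J\vec a^{\,3})_{ijk}\psi_{ijm}\big)$; - $\mathbb D^{\mathrm S}\cdot\tilde{\mathbf F}^v=\sum_m\big(\mathcal D_{im}(\tilde{\mathbf F}^v_1)_{mjk}+\mathcal D_{jm}(\tilde{\mathbf F}^v_2)_{imk}+\mathcal D_{km}(\tilde{\mathbf F}^v_3)_{ijm}\big)$ with $\tilde{\mathbf F}^v_i=\mathbf F^v\cdot J\vec a^{\,i}$. Here $\mathbf W=\mathbf w(\mathbf U)$ at the nodes, $\mathbf F^a=\mathbf f^a(\mathbf U)$, and $\mathbf F^v$ is $\mathbf f^v$ evaluated at the nodes with the auxiliary variable $\mathbf Q=(\mathbf Q_1,\mathbf Q_2,\mathbf Q_3)\in\mathbb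 R^{27}$ in place of $\vec\nabla\mathbf w$, i.e. $\mathbf F^v=\mathbf f^v\big(\mathbf U,(\tfrac{\partial\mathbf u}{\partial\mathbf w}(\mathbf U)\,\mathbf Q_\ell)_{\ell=1}^3\big)$. **Scheme.** On each element, for all polynomial test functions $\boldsymbol\varphi$ ($\mathbb R^9$-valued) and $\boldsymbol\vartheta$ ($\mathbb R^{27}$-valued) of degree $\le N$ in each variable: $$\begin{aligned}&\langle\mathbb I^N(J)\mathbf U_t,\boldsymbol\varphi\rangle_N+\langle\mathbb D\cdot\tilde{\mathbf F}^{a,\#},\boldsymbol\varphi\rangle_N+\int_{\partial E,N}\boldsymbol\varphi^T\{\mathbf F^{a,*}_n-\mathbf F^a_n\}\hat s\,\mathrm dS\\&+\langle\boldsymbol\Phi^{\mathrm{MHD}}\mathbb D^{\mathrm{NC}}_{\mathrm{div}}\cdot\tilde B,\boldsymbol\varphi\rangle_N+\int_{\partial E,N}\boldsymbol\varphi^T\{(\boldsymbol\Phi^{\mathrm{MHD}}B_n)^\Diamond-\boldsymbol\Phi^{\mathrm{MHD}}B_n\}\hat s\,\mathrm dS\\&+\langle\tilde{\boldsymbol\Phi}^{\mathrm{GLM}}\cdot\mathbb D^{\mathrm{NC}}_{\mathrm{grad}}\psi,\boldsymbol\varphi\rangle_N+\int_{\partial E,N}\boldsymbol\varphi^T\{(\boldsymbol\Phi^{\mathrm{GLM}}_n\psi)^\Diamond-\boldsymbol\Phi^{\mathrm{GLM}}_n\psi\}\hat s\,\mathrm dS\\&=\langle\mathbb D^{\mathrm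 S}\cdot\tilde{\mathbf F}^v,\boldsymbol\varphi\rangle_N+\int_{\partial E,N}\boldsymbol\varphi^T\{\mathbf F^{v,*}_n-\mathbf F^v_n\}\hat s\,\mathrm dS+\langle\mathbb I^N(J)\mathbf R,\boldsymbol\varphi\rangle_N,\\&\langle\mathbb I^N(J)\mathbf Q,\boldsymbol\vartheta\rangle_N=\int_{\partial E,N}(\mathbf W^* )^T(\boldsymbol\vartheta\cdot\vec n)\hat s\,\mathrm dS-\Big\langle\mathbf W,\sum_{i=1}^3\partial_{\xi^i}\mathbb I^N(\boldsymbol\vartheta\cdot J\vec a^{\,i})\Big\rangle_N .\end{aligned}$$ **Interfaces.** The mesh is conforming and fully periodic: every element face is glued to exactly one other element face, LGL nodes of the two faces coincide, $\hat s$ agrees from both sides and $\vec n$ only changes sign. In the equations for an element, "$-$" denotes the value from that element, "$+$" the value from the neighbour at the same interface node, $\vec n$ is outward from the element, $\{\!\{a\}\!\}=\tfrac12(a^-+a^+)$, and $\mathbf F^{\mathrm{EC}}\cdot\vec n=\mathbf F^{\mathrm{EC}}(\mathbf U^-,\mathbf U^+)\cdot\vec n$. *)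

theory Defs
  imports "HOL-Analysis.Analysis" "HOL-Computational_Algebra.Polynomial"
begin

section \<open>Resistive GLM-MHD equations\<close>

text \<open>A conserved state is the tuple (density, momentum, total energy, magnetic field, psi) in
  $R^9$; the product inner product is the Euclidean one.  A block vector of three states
  (a flux, or a gradient) is indexed by the space direction.\<close>

type_synonym state = "real \<times> (real^3) \<times> real \<times> (real^3) \<times> real"

definition dens :: "state \<Rightarrow> real" where "dens u = fst u"
definition mom :: "state \<Rightarrow> real^3" where "mom u = fst (snd u)"
definition energy :: "state \<Rightarrow> real" where "energy u = fst (snd (snd u))"
definition mag :: "state \<Rightarrow> real^3" where "mag u = fst (snd (snd (snd u)))"
definition glm :: "state \<Rightarrow> real" where "glm u = snd (snd (snd (snd u)))"

definition vel :: "state \<Rightarrow> real^3" where "vel u = (1 / dens u) *\<^sub>R mom u"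

record phys =
  adiab :: real     \<comment> \<open>adiabatic coefficient gamma\<close>
  mu_NS :: real
  mu_R :: real
  heat_cond :: real \<comment> \<open>kappa\<close>
  gas_const :: real \<comment> \<open>R\<close>
  damp :: real      \<comment> \<open>alpha\<close>
  glm_speed :: real \<comment> \<open>c_h\<close>

definition phys_ok :: "phys \<Rightarrow> bool" where
  "phys_ok P \<longleftrightarrow> adiab P > 1 \<and> mu_NS P > 0 \<and> mu_R P > 0 \<and> heat_cond P > 0
     \<and> gas_const P > 0 \<and> damp P \<ge> 0"

definition pressure :: "phys \<Rightarrow> state \<Rightarrow> real" where
  "pressure P u = (adiab P - 1) * (energy u - 1/2 * dens u * (norm (vel u))\<^sup>2
     - 1/2 * (norm (mag u))\<^sup>2 - 1/2 * (glm u)\<^sup>2)"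

definition admissible :: "phys \<Rightarrow> state set" where
  "admissible P = {u. dens u > 0 \<and> pressure P u > 0}"

definition spec_entropy :: "phys \<Rightarrow> state \<Rightarrow> real" where
  "spec_entropy P u = ln (pressure P u * dens u powr (- adiab P))"

definition entropy :: "phys \<Rightarrow> state \<Rightarrow> real" where
  "entropy P u = - (dens u * spec_entropy P u) / (adiab P - 1)"

definition beta :: "phys \<Rightarrow> state \<Rightarrow> real" where
  "beta P u = dens u / (2 * pressure P u)"

definition entropy_vars :: "phys \<Rightarrow> state \<Rightarrow> state" where
  "entropy_vars P u =
     ((adiab P - spec_entropy P u) / (adiab P - 1) - beta P u * (norm (vel u))\<^sup>2,
      (2 * beta P u) *\<^sub>R vel u,
      - 2 * beta P u,
      (2 * beta P u) *\<^sub>R mag u,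
      2 * beta P u * glm u)"

lemma pressure_alt:
  assumes "dens u \<noteq> 0"
  shows "pressure P u = (adiab P - 1) * (energy u - (mom u \<bullet> mom u) / (2 * dens u)
     - (mag u \<bullet> mag u) / 2 - (glm u)\<^sup>2 / 2)"
proof -
  have "dens u * (norm (vel u))\<^sup>2 = (mom u \<bullet> mom u) / dens u"
    unfolding power2_norm_eq_inner vel_def using assms by (simp add: field_simps)
  then show ?thesis
    unfolding pressure_def power2_norm_eq_inner by simp
qed

lemma entropy_vars_gradient:
  assumes "adiab P > 1" "dens u > 0" "pressure P u > 0"
  shows "(entropy P has_derivative (\<lambda>h. entropy_vars P u \<bullet> h)) (at u)"
proof -
  define g where "g = adiab P"
  define p where "p = (\<lambda>u. (g - 1) * (energy u - (mom u \<bullet> mom u) / (2 * dens u)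
     - (mag u \<bullet> mag u) / 2 - (glm u)\<^sup>2 / 2))"
  have pu: "pressure P u = p u" if "dens u > 0" for u
    using pressure_alt[of u P] that by (simp add: p_def g_def)
  have d: "(dens has_derivative dens) (at u)" "(mom has_derivative mom) (at u)"
    "(energy has_derivative energy) (at u)" "(mag has_derivative mag) (at u)"
    "(glm has_derivative glm) (at u)"
    unfolding dens_def[abs_def] mom_def[abs_def] energy_def[abs_def] mag_def[abs_def] glm_def[abs_def]
    by (auto intro!: derivative_eq_intros)
  define p' where "p' = (\<lambda>h. (g - 1) * (energy h - (mom u \<bullet> mom h) / dens u
     + (mom u \<bullet> mom u) * dens h / (2 * (dens u)\<^sup>2) - mag u \<bullet> mag h - glm u * glm h))"
  have dp: "(p has_derivative p') (at u)"
    unfolding p_def p'_def using assms(2)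
    by (auto intro!: derivative_eq_intros d simp: field_simps power2_eq_square inner_commute)
  have p0: "p u > 0" using assms pu by simp
  have "((\<lambda>u. - (dens u * (ln (p u) - g * ln (dens u))) / (g - 1)) has_derivative
     (\<lambda>h. - (dens h * (ln (p u) - g * ln (dens u)) + dens u * (p' h / p u - g * (dens h / dens u))) / (g - 1))) (at u)"
  proof -
    have "((\<lambda>u. dens u * (ln (p u) - g * ln (dens u))) has_derivative
       (\<lambda>h. dens h * (ln (p u) - g * ln (dens u)) + dens u * (p' h / p u - g * (dens h / dens u)))) (at u)"
      using assms p0 by (auto intro!: derivative_eq_intros d dp simp: algebra_simps divide_inverse)
    from has_derivative_mult_right[OF this, of "- 1 / (g - 1)"] show ?thesis by (simp only: times_divide_eq_left mult_minus1)
  qed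
  moreover have "- (dens h * (ln (p u) - g * ln (dens u)) + dens u * (p' h / p u - g * (dens h / dens u))) / (g - 1)
     = entropy_vars P u \<bullet> h" for h
  proof -
    have s: "spec_entropy P u = ln (p u) - g * ln (dens u)"
      using assms p0 by (simp add: spec_entropy_def pu ln_mult ln_powr g_def)
    have i: "a \<bullet> h = fst a * dens h + fst (snd a) \<bullet> mom h + fst (snd (snd a)) * energy h
       + fst (snd (snd (snd a))) \<bullet> mag h + snd (snd (snd (snd a))) * glm h" for a :: state
      by (simp add: inner_prod_def dens_def mom_def energy_def mag_def glm_def)
    have n: "(norm (vel u))\<^sup>2 = (mom u \<bullet> mom u) / (dens u)\<^sup>2"
      unfolding power2_norm_eq_inner vel_def by (simp add: power2_eq_square)
    have g1: "g - 1 \<noteq> 0" using assms g_def by simp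
    have "- (dens h * (ln (p u) - g * ln (dens u)) + dens u * (p' h / p u - g * (dens h / dens u))) / (g - 1)
      = dens h * ((g - (ln (p u) - g * ln (dens u))) / (g - 1)) - dens u / p u * (p' h / (g - 1))"
    proof -
      have "- (a * X + r * (q / p - g * (a / r))) / k = a * ((g - X) / k) - r / p * (q / k)"
        if "r \<noteq> 0" "p \<noteq> 0" "k \<noteq> 0" for a X r q p g k :: real
        using that by (simp add: divide_simps) (simp add: algebra_simps)
      from this[OF _ _ g1] show ?thesis using assms p0 by simp
    qed
    also have "p' h / (g - 1) = energy h - (mom u \<bullet> mom h) / dens u
     + (mom u \<bullet> mom u) * dens h / (2 * (dens u)\<^sup>2) - mag u \<bullet> mag h - glm u * glm h"
      using g1 by (simp add: p'_def)
    also have "dens h * ((g - (ln (p u) - g * ln (dens u))) / (g - 1)) - dens u / p u * \<dots> = entropy_vars P u \<bullet> h"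
      using assms p0 unfolding i entropy_vars_def s n fst_conv snd_conv beta_def pu[OF assms(2)] g_def[symmetric] unfolding vel_def inner_scaleR_left
      by (simp add: algebra_simps add_divide_distrib diff_divide_distrib power2_eq_square)
    finally show ?thesis .
  qed
  ultimately have "((\<lambda>u. - (dens u * (ln (p u) - g * ln (dens u))) / (g - 1)) has_derivative (\<lambda>h. entropy_vars P u \<bullet> h)) (at u)"
    by simp
  moreover have "\<forall>\<^sub>F x in nhds u. dens x > 0 \<and> p x > 0"
  proof -
    have "isCont dens u" "isCont p u" using d dp has_derivative_continuous by blast+
    then have "(dens \<longlongrightarrow> dens u) (nhds u)" "(p \<longlongrightarrow> p u) (nhds u)"
      by (simp_all add: continuous_at tendsto_at_iff_tendsto_nhds)
    then show ?thesis using assms p0 by (intro eventually_conj order_tendstoD)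
  qed
  then have "\<forall>\<^sub>F x in nhds u. - (dens x * (ln (p x) - g * ln (dens x))) / (g - 1) = entropy P x"
    by eventually_elim (simp add: entropy_def spec_entropy_def pu ln_mult ln_powr g_def)
  then have "\<forall>\<^sub>F x in at u. - (dens x * (ln (p x) - g * ln (dens x))) / (g - 1) = entropy P x"
    and "- (dens u * (ln (p u) - g * ln (dens u))) / (g - 1) = entropy P u"
    by (auto simp: eventually_nhds_conv_at)
  ultimately show ?thesis
    by (rule has_derivative_transform_eventually) auto
qed

lemma entropy_vars_inj:
  assumes g: "adiab P > 1"
  shows "inj_on (entropy_vars P) (admissible P)"
proof (rule inj_onI)
  fix a b assume ab: "a \<in> admissible P" "b \<in> admissible P" and eq: "entropy_vars P a = entropy_vars P b"
  have pos: "dens a > 0" "dens b > 0" "pressure P a > 0" "pressure P b > 0"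
    using ab by (auto simp: admissible_def)
  have be: "beta P a = beta P b" using eq by (simp add: entropy_vars_def)
  have b0: "beta P b > 0" using pos by (simp add: beta_def)
  have v: "vel a = vel b" and B: "mag a = mag b" and gl: "glm a = glm b"
    using eq be b0 by (auto simp: entropy_vars_def)
  have "(adiab P - spec_entropy P a) / (adiab P - 1) = (adiab P - spec_entropy P b) / (adiab P - 1)"
    using eq be v by (simp add: entropy_vars_def)
  then have s: "spec_entropy P a = spec_entropy P b" using g by simp
  have sp: "spec_entropy P u = ln (pressure P u) - adiab P * ln (dens u)"
    if "dens u > 0" "pressure P u > 0" for u
    using that by (simp add: spec_entropy_def ln_mult ln_powr)
  have lb: "ln (beta P u) = ln (dens u) - ln 2 - ln (pressure P u)"
    if "dens u > 0" "pressure P u > 0" for u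
    using that by (simp add: beta_def ln_div ln_mult)
  have "ln (dens a) - ln (pressure P a) = ln (dens b) - ln (pressure P b)"
    using lb[of a] lb[of b] be pos by simp
  moreover have "ln (pressure P a) - adiab P * ln (dens a) = ln (pressure P b) - adiab P * ln (dens b)"
    using sp[of a] sp[of b] s pos by simp
  ultimately have "(adiab P - 1) * (ln (dens a) - ln (dens b)) = 0"
    by (simp add: algebra_simps)
  then have "ln (dens a) = ln (dens b)" using g by simp
  then have r: "dens a = dens b" using pos by simp
  then have p: "pressure P a = pressure P b"
    using be pos by (simp add: beta_def)
  have m: "mom a = mom b" using v r pos by (simp add: vel_def)
  have "energy a = energy b"
    using p r v B gl g by (simp add: pressure_def)
  then show "a = b" using r m B gl
    by (simp add: dens_def mom_def energy_def mag_def glm_def prod_eq_iff)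
qed

text \<open>\<^term>\<open>du_dw P u\<close> is the Jacobian, at the entropy variables of \<open>u\<close>, of the map from
  entropy variables back to conserved variables.\<close>

definition cons_vars :: "phys \<Rightarrow> state \<Rightarrow> state" where
  "cons_vars P = inv_into (admissible P) (entropy_vars P)"

definition du_dw :: "phys \<Rightarrow> state \<Rightarrow> state \<Rightarrow> state" where
  "du_dw P u = frechet_derivative (cons_vars P) (at (entropy_vars P u))"

definition adv_flux :: "phys \<Rightarrow> state \<Rightarrow> state^3" where
  "adv_flux P u = (\<chi> l.
     let \<rho> = dens u; v = vel u; p = pressure P u; B = mag u; \<psi> = glm u; c = glm_speed P in
     (\<rho> * v $ l,
      (\<chi> k. \<rho> * v $ l * v $ k + (p + 1/2 * (norm B)\<^sup>2) * of_bool (l = k) - B $ l * B $ k),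
      v $ l * (1/2 * \<rho> * (norm v)\<^sup>2 + adiab P * p / (adiab P - 1) + (norm B)\<^sup>2)
        - B $ l * (v \<bullet> B) + c * \<psi> * B $ l,
      (\<chi> k. v $ l * B $ k - B $ l * v $ k + c * \<psi> * of_bool (l = k)),
      c * B $ l))"

text \<open>A derived quantity \<open>q\<close> of the state has, by the chain rule, the partial derivative
  \<open>Dq(u) (\<partial>\<^sub>l u)\<close>; the second argument of the viscous flux is the gradient of the state.\<close>

definition pd_of :: "(state \<Rightarrow> real) \<Rightarrow> state \<Rightarrow> state^3 \<Rightarrow> 3 \<Rightarrow> real" where
  "pd_of q u g l = frechet_derivative q (at u) (g $ l)"

definition curl_of :: "(3 \<Rightarrow> 3 \<Rightarrow> real) \<Rightarrow> real^3" where
  "curl_of d = vector [d 2 3 - d 3 2, d 3 1 - d 1 3, d 1 2 - d 2 1]"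

definition visc_flux :: "phys \<Rightarrow> state \<Rightarrow> state^3 \<Rightarrow> state^3" where
  "visc_flux P u g = (\<chi> l.
     let dv = (\<lambda>l k. pd_of (\<lambda>u. vel u $ k) u g l);
         dB = (\<lambda>l k. pd_of (\<lambda>u. mag u $ k) u g l);
         dT = pd_of (\<lambda>u. pressure P u / (gas_const P * dens u)) u g;
         \<tau> = (\<lambda>l k. mu_NS P * (dv l k + dv k l)
                - 2/3 * mu_NS P * (\<Sum>q\<in>UNIV. dv q q) * of_bool (l = k)) in
     (0,
      (\<chi> k. \<tau> l k),
      (\<Sum>k\<in>UNIV. \<tau> l k * vel u $ k) + heat_cond P * dT l
        - mu_R P * (cross3 (curl_of dB) (mag u)) $ l,
      (\<chi> k. mu_R P * (dB l k - dB k l)),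
      0))"

definition Phi_MHD :: "state \<Rightarrow> state" where
  "Phi_MHD u = (0, mag u, vel u \<bullet> mag u, vel u, 0)"

definition Phi_GLM :: "state \<Rightarrow> state^3" where
  "Phi_GLM u = (\<chi> l. (0, 0, vel u $ l * glm u, 0, vel u $ l))"

definition damp_source :: "phys \<Rightarrow> state \<Rightarrow> state" where
  "damp_source P u = (0, 0, 0, 0, - damp P * glm u)"

definition contract :: "('a::real_vector)^3 \<Rightarrow> real^3 \<Rightarrow> 'a"  (infixl "\<odot>" 70) where
  "G \<odot> c = (\<Sum>l\<in>UNIV. (c $ l) *\<^sub>R (G $ l))"


section \<open>Entropy conservative two-point flux\<close>

definition avg :: "'a::real_vector \<Rightarrow> 'a \<Rightarrow> 'a" where
  "avg a b = (1/2) *\<^sub>R (a + b)"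

definition logmean :: "real \<Rightarrow> real \<Rightarrow> real" where
  "logmean a b = (if a = b then a else (b - a) / (ln b - ln a))"

definition ec_flux :: "phys \<Rightarrow> state \<Rightarrow> state \<Rightarrow> state^3" where
  "ec_flux P uL uR = (\<chi> l.
     let c = glm_speed P;
         vL = vel uL; vR = vel uR; BL = mag uL; BR = mag uR; \<psi>L = glm uL; \<psi>R = glm uR;
         v = avg vL vR; B = avg BL BR; \<psi> = avg \<psi>L \<psi>R;
         \<rho>ln = logmean (dens uL) (dens uR);
         \<beta>ln = logmean (beta P uL) (beta P uR);
         pbar = avg (dens uL) (dens uR) / (2 * avg (beta P uL) (beta P uR));
         F\<rho> = \<rho>ln * v $ l;
         Fm = (\<lambda>k. \<rho>ln * v $ l * v $ k - B $ l * B $ k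
                + of_bool (l = k) * (pbar + 1/2 * (\<Sum>q\<in>UNIV. avg ((BL $ q)\<^sup>2) ((BR $ q)\<^sup>2))));
         FB = (\<lambda>k. v $ l * B $ k - v $ k * B $ l + of_bool (l = k) * c * \<psi>);
         F\<psi> = c * B $ l;
         FE = F\<rho> * (1 / (2 * (adiab P - 1) * \<beta>ln)
                      - 1/2 * (\<Sum>k\<in>UNIV. avg ((vL $ k)\<^sup>2) ((vR $ k)\<^sup>2)))
              + (\<Sum>k\<in>UNIV. Fm k * v $ k) + (\<Sum>k\<in>UNIV. FB k * B $ k) + F\<psi> * \<psi>
              - 1/2 * (\<Sum>k\<in>UNIV. avg (vL $ l * (BL $ k)\<^sup>2) (vR $ l * (BR $ k)\<^sup>2))
              + B $ l * (\<Sum>k\<in>UNIV. avg (vL $ k * BL $ k) (vR $ k * BR $ k))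
              - c * avg (BL $ l * \<psi>L) (BR $ l * \<psi>R)
     in (F\<rho>, (\<chi> k. Fm k), FE, (\<chi> k. FB k), F\<psi>))"


section \<open>Legendre-Gauss-Lobatto reference element\<close>

definition legendre :: "nat \<Rightarrow> real poly" where
  "legendre n = smult (1 / (2^n * fact n)) ((pderiv ^^ n) ([:-1, 0, 1:] ^ n))"

definition lgl_nodes :: "nat \<Rightarrow> (nat \<Rightarrow> real) \<Rightarrow> bool" where
  "lgl_nodes N \<xi> \<longleftrightarrow> strict_mono_on {..N} \<xi>
     \<and> \<xi> ` {..N} = {x. poly ([:1, 0, -1:] * pderiv (legendre N)) x = 0}"

definition lagrange :: "nat \<Rightarrow> (nat \<Rightarrow> real) \<Rightarrow> nat \<Rightarrow> real \<Rightarrow> real" where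
  "lagrange N \<xi> j x = (\<Prod>m\<in>{..N} - {j}. (x - \<xi> m) / (\<xi> j - \<xi> m))"

definition quad_weight :: "nat \<Rightarrow> (nat \<Rightarrow> real) \<Rightarrow> nat \<Rightarrow> real" where
  "quad_weight N \<xi> j = integral {-1..1} (lagrange N \<xi> j)"

definition diff_mat :: "nat \<Rightarrow> (nat \<Rightarrow> real) \<Rightarrow> nat \<Rightarrow> nat \<Rightarrow> real" where
  "diff_mat N \<xi> i m = deriv (lagrange N \<xi> m) (\<xi> i)"

text \<open>A node of an element is its multi-index; \<open>x(d := m)\<close> moves along the grid line in
  direction \<open>d\<close>.\<close>

type_synonym node = "3 \<Rightarrow> nat"

definition nodes :: "nat \<Rightarrow> node set" where
  "nodes N = {x. \<forall>d. x d \<le> N}"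

definition node_pt :: "(nat \<Rightarrow> real) \<Rightarrow> node \<Rightarrow> real^3" where
  "node_pt \<xi> x = (\<chi> d. \<xi> (x d))"

definition weight3 :: "nat \<Rightarrow> (nat \<Rightarrow> real) \<Rightarrow> node \<Rightarrow> real" where
  "weight3 N \<xi> x = (\<Prod>d\<in>UNIV. quad_weight N \<xi> (x d))"

definition tensor_polys :: "nat \<Rightarrow> (real^3 \<Rightarrow> 'a::real_vector) set" where
  "tensor_polys N = range (\<lambda>c y. \<Sum>a\<in>nodes N. (\<Prod>d\<in>UNIV. (y $ d) ^ a d) *\<^sub>R c a)"

definition interp :: "nat \<Rightarrow> (nat \<Rightarrow> real) \<Rightarrow> (node \<Rightarrow> 'a::real_vector) \<Rightarrow> real^3 \<Rightarrow> 'a" where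
  "interp N \<xi> f y = (\<Sum>x\<in>nodes N. (\<Prod>d\<in>UNIV. lagrange N \<xi> (x d) (y $ d)) *\<^sub>R f x)"

definition pd :: "3 \<Rightarrow> (real^3 \<Rightarrow> 'a::real_normed_vector) \<Rightarrow> real^3 \<Rightarrow> 'a" where
  "pd i F y = frechet_derivative F (at y) (axis i 1)"

definition inner_N ::
  "nat \<Rightarrow> (nat \<Rightarrow> real) \<Rightarrow> (node \<Rightarrow> 'a::real_inner) \<Rightarrow> (node \<Rightarrow> 'a) \<Rightarrow> real" where
  "inner_N N \<xi> f g = (\<Sum>x\<in>nodes N. weight3 N \<xi> x * (f x \<bullet> g x))"

text \<open>The face \<open>(d, True)\<close> is \<open>\<xi>\<^sup>d = 1\<close>, and \<open>(d, False)\<close> is \<open>\<xi>\<^sup>d = -1\<close>.\<close>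

type_synonym face = "3 \<times> bool"

definition face_nodes :: "nat \<Rightarrow> face \<Rightarrow> node set" where
  "face_nodes N f = {x \<in> nodes N. x (fst f) = (if snd f then N else 0)}"


section \<open>Mesh\<close>

text \<open>\<^item> Elements are numbered from 1 to \<open>n_el\<close>.
  \<^item> \<open>met M \<nu> x $ i\<close> is the volume-weighted contravariant vector \<open>J a\<^sup>i\<close>.
  \<^item> \<open>nbr M (\<nu>, f)\<close> is the element face glued to face \<open>f\<close> of element \<open>\<nu>\<close>.
  \<^item> \<open>nbr_node M (\<nu>, f) x\<close> is the node of the glued face that coincides with node \<open>x\<close>.\<close>

record mesh =
  n_el :: nat
  jac :: "nat \<Rightarrow> node \<Rightarrow> real"
  met :: "nat \<Rightarrow> node \<Rightarrow> real^3^3"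
  nbr :: "nat \<times> face \<Rightarrow> nat \<times> face"
  nbr_node :: "nat \<times> face \<Rightarrow> node \<Rightarrow> node"

definition elements :: "mesh \<Rightarrow> nat set" where
  "elements M = {1..n_el M}"

definition surf_elem :: "mesh \<Rightarrow> nat \<Rightarrow> face \<Rightarrow> node \<Rightarrow> real" where
  "surf_elem M \<nu> f x = norm (met M \<nu> x $ fst f)"

definition normal :: "mesh \<Rightarrow> nat \<Rightarrow> face \<Rightarrow> node \<Rightarrow> real^3" where
  "normal M \<nu> f x = (if snd f then 1 else -1) *\<^sub>R sgn (met M \<nu> x $ fst f)"

text \<open>Where a metric vector vanishes the normal is 0; such nodes carry surface element 0.\<close>

definition surf_int ::
  "nat \<Rightarrow> (nat \<Rightarrow> real) \<Rightarrow> mesh \<Rightarrow> nat \<Rightarrow> (face \<Rightarrow> node \<Rightarrow> real) \<Rightarrow> real" where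
  "surf_int N \<xi> M \<nu> g = (\<Sum>f\<in>UNIV. \<Sum>x\<in>face_nodes N f.
     (\<Prod>e\<in>UNIV - {fst f}. quad_weight N \<xi> (x e)) * g f x * surf_elem M \<nu> f x)"

definition positive_jacobians :: "nat \<Rightarrow> mesh \<Rightarrow> bool" where
  "positive_jacobians N M \<longleftrightarrow> (\<forall>\<nu>\<in>elements M. \<forall>x\<in>nodes N. jac M \<nu> x > 0)"

definition metric_identities :: "nat \<Rightarrow> (nat \<Rightarrow> real) \<Rightarrow> mesh \<Rightarrow> bool" where
  "metric_identities N \<xi> M \<longleftrightarrow> (\<forall>\<nu>\<in>elements M. \<forall>n. \<forall>y\<in>{y. \<forall>d. \<bar>y $ d\<bar> \<le> 1}.
     (\<Sum>i\<in>UNIV. pd i (interp N \<xi> (\<lambda>x. met M \<nu> x $ i $ n)) y) = 0)"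

text \<open>Two glued faces are matched by one of the eight symmetries of the reference square: a
  bijection \<open>\<pi>\<close> between their tangential directions, together with a set \<open>R\<close> of reversed directions.\<close>

definition face_symmetry :: "nat \<Rightarrow> face \<Rightarrow> face \<Rightarrow> (node \<Rightarrow> node) \<Rightarrow> bool" where
  "face_symmetry N f f' h \<longleftrightarrow>
     (\<exists>\<pi> R. bij_betw \<pi> (UNIV - {fst f}) (UNIV - {fst f'}) \<and>
        (\<forall>x\<in>face_nodes N f. h x \<in> face_nodes N f' \<and>
           (\<forall>e. e \<noteq> fst f \<longrightarrow> h x (\<pi> e) = (if e \<in> R then N - x e else x e))))"

definition conforming_periodic :: "nat \<Rightarrow> mesh \<Rightarrow> bool" where
  "conforming_periodic N M \<longleftrightarrow>
     (\<forall>\<nu>\<in>elements M. \<forall>f \<nu>' f'. nbr M (\<nu>, f) = (\<nu>', f') \<longrightarrow>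
        \<nu>' \<in> elements M \<and> (\<nu>', f') \<noteq> (\<nu>, f) \<and> nbr M (\<nu>', f') = (\<nu>, f) \<and>
        face_symmetry N f f' (nbr_node M (\<nu>, f)) \<and>
        (\<forall>x\<in>face_nodes N f.
           let x' = nbr_node M (\<nu>, f) x in
           nbr_node M (\<nu>', f') x' = x \<and>
           surf_elem M \<nu>' f' x' = surf_elem M \<nu> f x \<and>
           normal M \<nu>' f' x' = - normal M \<nu> f x))"

definition ext_val :: "mesh \<Rightarrow> (nat \<Rightarrow> node \<Rightarrow> 'a) \<Rightarrow> nat \<Rightarrow> face \<Rightarrow> node \<Rightarrow> 'a" where
  "ext_val M U \<nu> f x = U (fst (nbr M (\<nu>, f))) (nbr_node M (\<nu>, f) x)"


section \<open>Split-form DGSEM\<close>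

text \<open>The volume operators act on the nodal values in one element; \<open>A\<close> is the nodal metric.\<close>

definition div_split :: "nat \<Rightarrow> (nat \<Rightarrow> real) \<Rightarrow> (state \<Rightarrow> state \<Rightarrow> state^3)
    \<Rightarrow> (node \<Rightarrow> real^3^3) \<Rightarrow> (node \<Rightarrow> state) \<Rightarrow> node \<Rightarrow> state" where
  "div_split N \<xi> F A U x = (\<Sum>d\<in>UNIV. 2 *\<^sub>R (\<Sum>m\<le>N. diff_mat N \<xi> (x d) m *\<^sub>R
     (F (U x) (U (x(d := m))) \<odot> avg (A x $ d) (A (x(d := m)) $ d))))"

definition div_NC :: "nat \<Rightarrow> (nat \<Rightarrow> real) \<Rightarrow> (node \<Rightarrow> real^3^3) \<Rightarrow> (node \<Rightarrow> state) \<Rightarrow> node \<Rightarrow> state"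
  where
  "div_NC N \<xi> A U x = (\<Sum>m\<le>N. \<Sum>d\<in>UNIV. diff_mat N \<xi> (x d) m *
     (mag (U (x(d := m))) \<bullet> avg (A x $ d) (A (x(d := m)) $ d))) *\<^sub>R Phi_MHD (U x)"

definition grad_NC :: "nat \<Rightarrow> (nat \<Rightarrow> real) \<Rightarrow> (node \<Rightarrow> real^3^3) \<Rightarrow> (node \<Rightarrow> state) \<Rightarrow> node \<Rightarrow> state"
  where
  "grad_NC N \<xi> A U x = (\<Sum>m\<le>N. \<Sum>d\<in>UNIV. (diff_mat N \<xi> (x d) m * glm (U (x(d := m)))) *\<^sub>R
     (Phi_GLM (U x) \<odot> (A x $ d)))"

definition div_std :: "nat \<Rightarrow> (nat \<Rightarrow> real) \<Rightarrow> (node \<Rightarrow> real^3^3) \<Rightarrow> (node \<Rightarrow> state^3) \<Rightarrow> node \<Rightarrow> state"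
  where
  "div_std N \<xi> A G x = (\<Sum>m\<le>N. \<Sum>d\<in>UNIV. diff_mat N \<xi> (x d) m *\<^sub>R
     (G (x(d := m)) \<odot> (A (x(d := m)) $ d)))"

definition visc_nodal :: "phys \<Rightarrow> state \<Rightarrow> state^3 \<Rightarrow> state^3" where
  "visc_nodal P u q = visc_flux P u (\<chi> l. du_dw P u (q $ l))"

text \<open>Interface choices. \<open>Fa_num\<close>, \<open>mhd_num\<close> and \<open>glm_num\<close> are given the inner state, the outer
  state and the outward normal of the element; \<open>Fv_num\<close> the two viscous block fluxes and the
  normal; \<open>W_num\<close> the two values of the entropy variables.\<close>

record num_choice =
  Fa_vol :: "state \<Rightarrow> state \<Rightarrow> state^3"
  Fa_num :: "state \<Rightarrow> state \<Rightarrow> real^3 \<Rightarrow> state"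
  mhd_num :: "state \<Rightarrow> state \<Rightarrow> real^3 \<Rightarrow> state"
  glm_num :: "state \<Rightarrow> state \<Rightarrow> real^3 \<Rightarrow> state"
  Fv_num :: "state^3 \<Rightarrow> state^3 \<Rightarrow> real^3 \<Rightarrow> state"
  W_num :: "state \<Rightarrow> state \<Rightarrow> state"

definition main_equation :: "phys \<Rightarrow> nat \<Rightarrow> (nat \<Rightarrow> real) \<Rightarrow> mesh \<Rightarrow> num_choice
    \<Rightarrow> (nat \<Rightarrow> node \<Rightarrow> state) \<Rightarrow> (nat \<Rightarrow> node \<Rightarrow> state) \<Rightarrow> (nat \<Rightarrow> node \<Rightarrow> state^3)
    \<Rightarrow> nat \<Rightarrow> (real^3 \<Rightarrow> state) \<Rightarrow> bool" where
  "main_equation P N \<xi> M H U Ut Q \<nu> \<phi> \<longleftrightarrow>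
    (let A = met M \<nu>; J = jac M \<nu>; u = U \<nu>; ue = ext_val M U \<nu>; n = normal M \<nu>;
         Fv = (\<lambda>\<nu> x. visc_nodal P (U \<nu> x) (Q \<nu> x));
         \<phi>N = (\<lambda>x. \<phi> (node_pt \<xi> x));
         vol = (\<lambda>g. inner_N N \<xi> g \<phi>N);
         surf = (\<lambda>g. surf_int N \<xi> M \<nu> (\<lambda>f x. \<phi>N x \<bullet> g f x))
     in
       vol (\<lambda>x. J x *\<^sub>R Ut \<nu> x)
       + vol (div_split N \<xi> (Fa_vol H) A u)
       + surf (\<lambda>f x. Fa_num H (u x) (ue f x) (n f x) - adv_flux P (u x) \<odot> n f x)
       + vol (div_NC N \<xi> A u)
       + surf (\<lambda>f x. mhd_num H (u x) (ue f x) (n f x)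
                    - (mag (u x) \<bullet> n f x) *\<^sub>R Phi_MHD (u x))
       + vol (grad_NC N \<xi> A u)
       + surf (\<lambda>f x. glm_num H (u x) (ue f x) (n f x)
                    - glm (u x) *\<^sub>R (Phi_GLM (u x) \<odot> n f x))
       = vol (div_std N \<xi> A (Fv \<nu>))
       + surf (\<lambda>f x. Fv_num H (Fv \<nu> x) (ext_val M Fv \<nu> f x) (n f x) - Fv \<nu> x \<odot> n f x)
       + vol (\<lambda>x. J x *\<^sub>R damp_source P (u x)))"

definition gradient_equation :: "phys \<Rightarrow> nat \<Rightarrow> (nat \<Rightarrow> real) \<Rightarrow> mesh \<Rightarrow> num_choice
    \<Rightarrow> (nat \<Rightarrow> node \<Rightarrow> state) \<Rightarrow> (nat \<Rightarrow> node \<Rightarrow> state^3) \<Rightarrow> nat \<Rightarrow> (real^3 \<Rightarrow> state^3) \<Rightarrow> bool" where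
  "gradient_equation P N \<xi> M H U Q \<nu> \<theta> \<longleftrightarrow>
    (let A = met M \<nu>; J = jac M \<nu>; W = (\<lambda>\<nu> x. entropy_vars P (U \<nu> x));
         \<theta>N = (\<lambda>x. \<theta> (node_pt \<xi> x))
     in
       inner_N N \<xi> (\<lambda>x. J x *\<^sub>R Q \<nu> x) \<theta>N
       = surf_int N \<xi> M \<nu> (\<lambda>f x.
           W_num H (W \<nu> x) (ext_val M W \<nu> f x) \<bullet> (\<theta>N x \<odot> normal M \<nu> f x))
       - inner_N N \<xi> (W \<nu>) (\<lambda>x. \<Sum>i\<in>UNIV.
           pd i (interp N \<xi> (\<lambda>z. \<theta>N z \<odot> (A z $ i))) (node_pt \<xi> x)))"

definition dgsem_solution :: "phys \<Rightarrow> nat \<Rightarrow> (nat \<Rightarrow> real) \<Rightarrow> mesh \<Rightarrow> num_choice \<Rightarrow> real set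
    \<Rightarrow> (real \<Rightarrow> nat \<Rightarrow> node \<Rightarrow> state) \<Rightarrow> (real \<Rightarrow> nat \<Rightarrow> node \<Rightarrow> state^3) \<Rightarrow> bool" where
  "dgsem_solution P N \<xi> M H T U Q \<longleftrightarrow> (\<exists>Ut. \<forall>t\<in>T.
     (\<forall>\<nu>\<in>elements M. \<forall>x\<in>nodes N.
        ((\<lambda>s. U s \<nu> x) has_vector_derivative Ut t \<nu> x) (at t within T)) \<and>
     (\<forall>\<nu>\<in>elements M.
        (\<forall>\<phi>\<in>tensor_polys N. main_equation P N \<xi> M H (U t) (Ut t) (Q t) \<nu> \<phi>) \<and>
        (\<forall>\<theta>\<in>tensor_polys N. gradient_equation P N \<xi> M H (U t) (Q t) \<nu> \<theta>)))"

definition total_entropy ::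
  "phys \<Rightarrow> nat \<Rightarrow> (nat \<Rightarrow> real) \<Rightarrow> mesh \<Rightarrow> (nat \<Rightarrow> node \<Rightarrow> state) \<Rightarrow> real" where
  "total_entropy P N \<xi> M U =
     (\<Sum>\<nu>\<in>elements M. \<Sum>x\<in>nodes N. weight3 N \<xi> x * jac M \<nu> x * entropy P (U \<nu> x))"

end

theory Submission
  imports Defs
begin

text \<open>The scheme is tested with its own entropy variables. In each element take the interpolant of the
  nodal entropy variables \<open>W\<close> as test function in the main equation and the interpolant of the
  viscous flux in the gradient equation. By the chain rule the first term of the main equation is
  then the time derivative of the discrete entropy of the element. All other terms must be shown to
  be face terms that cancel between neighbouring elements, or terms with a sign.

  Advection. The quadrature is exact for degree below \<open>2 N\<close> (\<open>quadrature_exact\<close>), which makes the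
  derivative matrix satisfy summation by parts along every grid line (\<open>line_form_transpose\<close>). This
  turns the tested flux divergence into face terms plus a sum of differences of \<open>W\<close> between two nodes,
  contracted with the two-point flux. The entropy conservative flux is built so that this contraction
  is \<open>[[\<Psi>]] - {{B}} [[\<theta>]]\<close> (\<open>ec_flux_jump\<close>), where \<open>\<Psi>\<close> is the entropy flux potential and \<open>\<theta>\<close> is the
  contraction of \<open>W\<close> with the non-conservative vector of the MHD equations. The tested
  non-conservative MHD term completes \<open>{{B}} [[\<theta>]]\<close> to the jump of \<open>\<theta> B / 2\<close> plus a form symmetric in
  the two nodes. Symmetric forms reduce to face terms. The jumps, multiplied by averaged metric terms,
  reduce to face terms plus a multiple of the discrete divergence of the metric terms, which is zero
  by the metric identities (\<open>volume_entropy_balance\<close>). The GLM term is orthogonal to \<open>W\<close>. The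
  face terms that remain change sign when the two sides of an interface are exchanged, again
  by \<open>ec_flux_jump\<close>, so they cancel in the sum over a periodic mesh (\<open>interface_cancellation\<close>).

  Viscosity. The gradient equation replaces the tested viscous term by face terms, which cancel in the
  same way for the averaged interface values, minus the inner product of \<open>J Q\<close> with the viscous flux.
  As a function of the gradient of the entropy variables the viscous flux is positive semidefinite
  (\<open>visc_nodal_dissipative\<close>); since Jacobians and quadrature weights are positive, this inner
  product is nonnegative. The damping source contributes \<open>- 2 \<beta> \<alpha> \<psi>\<^sup>2 \<le> 0\<close>.\<close>

section \<open>Integrals of polynomials over the reference interval\<close>

definition ref_integral :: "real poly \<Rightarrow> real" where
  "ref_integral p = integral {-1..1} (poly p)"

lemma poly_integrable: "poly (p :: real poly) integrable_on {a..b}"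
  by (intro integrable_continuous_real continuous_intros)

lemma ref_integral_add: "ref_integral (p + q) = ref_integral p + ref_integral q"
  unfolding ref_integral_def poly_add by (rule integral_add) (rule poly_integrable)+

lemma ref_integral_smult: "ref_integral (smult c p) = c * ref_integral p"
  unfolding ref_integral_def poly_smult by (rule integral_mult_right)

lemma ref_integral_0 [simp]: "ref_integral 0 = 0"
  using ref_integral_smult[of 0 0] by simp

lemma ref_integral_sum: "ref_integral (sum f A) = (\<Sum>a\<in>A. ref_integral (f a))"
  by (induction A rule: infinite_finite_induct) (auto simp: ref_integral_add)

lemma ref_integral_pderiv: "ref_integral (pderiv p) = poly p 1 - poly p (-1)"
proof -
  have "(poly (pderiv p) has_integral poly p 1 - poly p (-1)) {-1..1}"
    by (intro fundamental_theorem_of_calculus)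
       (auto intro!: DERIV_subset[OF poly_DERIV] simp flip: has_real_derivative_iff_has_vector_derivative)
  then show ?thesis unfolding ref_integral_def by (rule integral_unique)
qed

lemma ref_integral_by_parts:
  "ref_integral (pderiv p * q) = poly (p * q) 1 - poly (p * q) (-1) - ref_integral (p * pderiv q)"
  using ref_integral_pderiv[of "p * q"] by (simp add: pderiv_mult ref_integral_add mult.commute)

lemma ref_integral_pos:
  assumes "p \<noteq> 0" and nonneg: "\<And>x. \<bar>x\<bar> \<le> 1 \<Longrightarrow> poly p x \<ge> 0"
  shows "ref_integral p > 0"
proof (rule ccontr)
  assume "\<not> ref_integral p > 0"
  moreover have "ref_integral p \<ge> 0"
    unfolding ref_integral_def by (rule integral_nonneg[OF poly_integrable]) (auto intro!: nonneg)
  ultimately have "integral {-1..1} (poly p) = 0" by (simp add: ref_integral_def)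
  then have "\<forall>x\<in>{-1..1}. poly p x = 0"
    by (subst (asm) integral_eq_0_iff) (auto intro!: nonneg continuous_intros)
  then have "{-1..1} \<subseteq> {x. poly p x = 0}" by auto
  then have "finite {-1..1::real}"
    using finite_subset poly_roots_finite[OF assms(1)] by blast
  moreover have "infinite {-1..1::real}" by (rule infinite_Icc) simp
  ultimately show False by blast
qed

section \<open>Legendre polynomials\<close>

text \<open>Each differentiation lowers the multiplicity of a factor by at most one. For \<open>b = x\<^sup>2 - 1\<close> this says
  that the derivatives of order below \<open>N\<close> of the polynomial in Rodrigues' formula vanish at both ends.\<close>

lemma pderiv_funpow_power_dvd:
  fixes b :: "'a :: {comm_semiring_1, semiring_no_zero_divisors} poly"
  shows "n \<le> N \<Longrightarrow> b ^ (N - n) dvd (pderiv ^^ n) (b ^ N)"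
proof (induction n)
  case (Suc n)
  then obtain s where s: "(pderiv ^^ n) (b ^ N) = b ^ Suc (N - Suc n) * s"
    by (auto simp: Suc_diff_Suc elim!: dvdE)
  have "(pderiv ^^ Suc n) (b ^ N)
      = b ^ (N - Suc n) * (smult (of_nat (Suc (N - Suc n))) (pderiv b * s) + b * pderiv s)"
    by (simp add: s pderiv_mult pderiv_power_Suc algebra_simps del: power_Suc)
       (simp add: algebra_simps)
  then show ?case by (metis dvd_triv_left)
qed simp

text \<open>Integrate by parts \<open>N\<close> times in Rodrigues' formula: no boundary terms arise, and \<open>N\<close> derivatives
  annihilate \<open>q\<close>.\<close>

lemma legendre_orthogonal:
  assumes "degree q < N"
  shows "ref_integral (legendre N * q) = 0"
proof -
  define b :: "real poly" where "b = [:-1, 0, 1:]"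
  have vanish: "poly ((pderiv ^^ n) (b ^ N)) x = 0" if "n < N" "x = 1 \<or> x = -1" for n x
  proof -
    have "b dvd b ^ (N - n)" using that by (simp add: dvd_power)
    then have "b dvd (pderiv ^^ n) (b ^ N)"
      using pderiv_funpow_power_dvd[of n N b] that dvd_trans by fastforce
    moreover have "poly b x = 0" using that by (auto simp: b_def)
    ultimately show ?thesis by (auto elim!: dvdE)
  qed
  have "n \<le> N \<Longrightarrow> degree q < n \<or> q = 0 \<Longrightarrow> ref_integral ((pderiv ^^ n) (b ^ N) * q) = 0" for n q
  proof (induction n arbitrary: q)
    case (Suc n)
    have "degree (pderiv q) < n \<or> pderiv q = 0"
      using Suc.prems by (auto simp: degree_pderiv pderiv_eq_0_iff)
    then show ?case
      using Suc by (simp add: ref_integral_by_parts vanish)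
  qed simp
  from this[of N q] show ?thesis
    using assms by (simp add: legendre_def b_def ref_integral_smult)
qed

lemma degree_legendre: "degree (legendre N) = N"
proof -
  have "degree ((pderiv ^^ n) p) = degree p - n" for n and p :: "real poly"
    by (induction n) (auto simp: degree_pderiv)
  then show ?thesis
    by (simp add: legendre_def degree_power_eq)
qed

text \<open>The parity behind the mirror symmetry of the nodes.\<close>

lemma poly_pderiv_funpow_minus:
  fixes p :: "real poly"
  assumes "\<And>x. poly p (-x) = poly p x"
  shows "poly ((pderiv ^^ n) p) (-x) = (-1) ^ n * poly ((pderiv ^^ n) p) x"
proof -
  have *: "pderiv (pcompose q [:0, -1:]) = - pcompose (pderiv q) [:0, -1:]" for q :: "real poly"
    by (simp add: pderiv_pcompose pderiv_pCons)
  have 0: "pcompose p [:0, -1:] = p"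
    by (rule poly_ext) (simp add: poly_pcompose assms)
  have "pcompose ((pderiv ^^ n) p) [:0, -1:] = smult ((-1) ^ n) ((pderiv ^^ n) p)"
  proof (induction n)
    case (Suc n)
    have "pcompose ((pderiv ^^ Suc n) p) [:0, -1:] = - pderiv (pcompose ((pderiv ^^ n) p) [:0, -1:])"
      by (simp add: *)
    also have "\<dots> = smult ((-1) ^ Suc n) ((pderiv ^^ Suc n) p)"
      by (simp add: Suc pderiv_smult)
    finally show ?case .
  qed (simp add: 0)
  from arg_cong[OF this, of "\<lambda>q. poly q x"] show ?thesis
    by (simp add: poly_pcompose)
qed

section \<open>The nodal polynomial\<close>

text \<open>Up to a constant factor, the nodal polynomial of the Legendre-Gauss-Lobatto nodes.\<close>

definition lobatto :: "nat \<Rightarrow> real poly" where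
  "lobatto N = [:1, 0, -1:] * pderiv (legendre N)"

lemma poly_lobatto: "poly (lobatto N) x = (1 - x\<^sup>2) * poly (pderiv (legendre N)) x"
  by (simp add: lobatto_def algebra_simps power2_eq_square)

lemma lobatto_nonzero: "N \<ge> 1 \<Longrightarrow> lobatto N \<noteq> 0"
  unfolding lobatto_def mult_eq_0_iff by (simp add: pderiv_eq_0_iff degree_legendre)

lemma degree_lobatto:
  assumes "N \<ge> 1" shows "degree (lobatto N) = Suc N"
proof -
  have "pderiv (legendre N) \<noteq> 0" using lobatto_nonzero[OF assms] by (auto simp: lobatto_def)
  then show ?thesis unfolding lobatto_def using assms
    by (subst degree_mult_eq) (auto simp: degree_pderiv degree_legendre)
qed

text \<open>One integration by parts moves the derivative off the Legendre polynomial. The factor \<open>1 - x\<^sup>2\<close>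
  removes the boundary terms, and the other factor that remains has degree below \<open>N\<close>.\<close>

lemma lobatto_orthogonal:
  assumes "q = 0 \<or> degree q + 1 < N"
  shows "ref_integral (lobatto N * q) = 0"
proof -
  have "ref_integral (lobatto N * q) = ref_integral (pderiv (legendre N) * ([:1, 0, -1:] * q))"
    by (simp only: lobatto_def mult.commute mult.left_commute)
  also have "\<dots> = - ref_integral (legendre N * pderiv ([:1, 0, -1:] * q))"
    by (simp add: ref_integral_by_parts del: mult_pCons_left)
  also have "ref_integral (legendre N * pderiv ([:1, 0, -1:] * q)) = 0"
  proof (cases "q = 0")
    case False
    then have "degree (pderiv ([:1, 0, -1:] * q)) = degree q + 1"
      by (subst degree_pderiv, subst degree_mult_eq) auto
    with False assms show ?thesis by (intro legendre_orthogonal) auto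
  qed simp
  finally show ?thesis by simp
qed

text \<open>A root \<open>r\<close> outside the interval is a root of the derivative \<open>(x - r) g\<close> of the Legendre polynomial.
  Then \<open>(1 - x\<^sup>2) (x - r) g\<^sup>2\<close> has one sign on the interval, although its integral vanishes
  because \<open>g\<close> has degree at most \<open>N - 2\<close>.\<close>

lemma lobatto_root_bound:
  assumes N: "N \<ge> 1" and r: "poly (lobatto N) r = 0"
  shows "\<bar>r\<bar> \<le> 1"
proof (rule ccontr)
  assume "\<not> \<bar>r\<bar> \<le> 1"
  then have r1: "\<bar>r\<bar> > 1" by simp
  then have "r\<^sup>2 \<noteq> 1" by (metis abs_square_eq_1 less_irrefl)
  with r have "poly (pderiv (legendre N)) r = 0" by (simp add: poly_lobatto)
  then obtain g where g: "pderiv (legendre N) = [:-r, 1:] * g"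
    by (auto simp: poly_eq_0_iff_dvd elim!: dvdE)
  have nz: "pderiv (legendre N) \<noteq> 0" using lobatto_nonzero[OF N] by (auto simp: lobatto_def)
  then have g0: "g \<noteq> 0" using g by auto
  have "N - 1 = degree (pderiv (legendre N))" by (simp add: degree_pderiv degree_legendre)
  also have "\<dots> = 1 + degree g" unfolding g using g0 by (subst degree_mult_eq) auto
  finally have dg: "degree g + 1 < N" using N by simp
  \<comment> \<open>The sign makes this nonnegative on the interval.\<close>
  define h where "h = smult (- sgn r) (lobatto N * g)"
  have "poly h x \<ge> 0" if "\<bar>x\<bar> \<le> 1" for x
  proof -
    have "poly h x = (1 - x\<^sup>2) * (sgn r * (r - x)) * (poly g x)\<^sup>2"
      by (simp add: h_def poly_lobatto g power2_eq_square algebra_simps)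
    moreover have "x\<^sup>2 \<le> 1" using that by (simp add: abs_square_le_1)
    moreover have "sgn r * (r - x) \<ge> 0"
      using r1 that by (auto simp: sgn_if abs_if split: if_splits)
    ultimately show ?thesis by simp
  qed
  moreover have "h \<noteq> 0" using r1 g0 lobatto_nonzero[OF N] by (auto simp: h_def sgn_if)
  ultimately have "ref_integral h > 0" by (intro ref_integral_pos) auto
  moreover have "ref_integral h = 0" using dg by (simp only: h_def ref_integral_smult) (simp add: lobatto_orthogonal)
  ultimately show False by simp
qed


section \<open>Lagrange basis\<close>

definition lagrange_poly :: "nat \<Rightarrow> (nat \<Rightarrow> real) \<Rightarrow> nat \<Rightarrow> real poly" where
  "lagrange_poly N \<xi> j = (\<Prod>m\<in>{..N} - {j}. smult (1 / (\<xi> j - \<xi> m)) [:- \<xi> m, 1:])"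

lemma poly_lagrange_poly: "poly (lagrange_poly N \<xi> j) = lagrange N \<xi> j"
  by (auto simp: fun_eq_iff lagrange_poly_def lagrange_def poly_prod intro!: prod.cong)
     (simp add: diff_divide_distrib)

lemma degree_lagrange_poly:
  assumes "j \<le> N" shows "degree (lagrange_poly N \<xi> j) \<le> N"
proof -
  have "degree (lagrange_poly N \<xi> j)
      \<le> (\<Sum>m\<in>{..N} - {j}. degree (smult (1 / (\<xi> j - \<xi> m)) [:- \<xi> m, 1:]))"
    unfolding lagrange_poly_def by (rule order_trans[OF degree_prod_sum_le]) auto
  also have "\<dots> \<le> (\<Sum>m\<in>{..N} - {j}. 1)"
  proof (rule sum_mono)
    show "degree (smult (1 / (\<xi> j - \<xi> m)) [:- \<xi> m, 1:]) \<le> 1" for m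
      by (rule order_trans[OF degree_smult_le]) simp
  qed
  also have "\<dots> = N" using assms by simp
  finally show ?thesis .
qed

lemma quad_weight_ref_integral: "quad_weight N \<xi> j = ref_integral (lagrange_poly N \<xi> j)"
  by (simp add: quad_weight_def ref_integral_def poly_lagrange_poly)

lemma lagrange_has_derivative:
  "(lagrange N \<xi> j has_real_derivative deriv (lagrange N \<xi> j) x) (at x)"
  unfolding poly_lagrange_poly[symmetric]
  using poly_DERIV[of "lagrange_poly N \<xi> j" x] DERIV_imp_deriv by metis

lemma diff_mat_poly: "diff_mat N \<xi> i m = poly (pderiv (lagrange_poly N \<xi> m)) (\<xi> i)"
  unfolding diff_mat_def poly_lagrange_poly[symmetric] by (rule DERIV_imp_deriv[OF poly_DERIV])

locale distinct_nodes =
  fixes N :: nat and \<xi> :: "nat \<Rightarrow> real"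
  assumes inj_nodes: "inj_on \<xi> {..N}"
begin

lemma lagrange_node:
  assumes "i \<le> N" "j \<le> N"
  shows "lagrange N \<xi> j (\<xi> i) = of_bool (i = j)"
proof (cases "i = j")
  case True
  have "\<xi> j \<noteq> \<xi> m" if "m \<in> {..N} - {j}" for m
    using that assms inj_nodes by (auto dest: inj_onD)
  then show ?thesis using True by (auto simp: lagrange_def intro!: prod.neutral)
next
  case False
  then show ?thesis using assms by (auto simp: lagrange_def)
qed

lemma lagrange_interpolation:
  assumes "degree p \<le> N"
  shows "p = (\<Sum>j\<le>N. smult (poly p (\<xi> j)) (lagrange_poly N \<xi> j))" (is "p = ?r")
proof (rule poly_eqI_degree)
  show "poly p x = poly ?r x" if "x \<in> \<xi> ` {..N}" for x
  proof -
    from that obtain i where i: "i \<le> N" "x = \<xi> i" by auto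
    have "poly ?r x = (\<Sum>j\<le>N. poly p (\<xi> j) * of_bool (i = j))"
      by (simp add: poly_sum i lagrange_node poly_lagrange_poly)
    also have "\<dots> = poly p x" using i by simp
    finally show ?thesis ..
  qed
  have "card (\<xi> ` {..N}) = Suc N" using inj_nodes by (simp add: card_image)
  moreover have "degree ?r \<le> N"
    by (intro degree_sum_le order_trans[OF degree_smult_le] degree_lagrange_poly) auto
  ultimately show "card (\<xi> ` {..N}) > degree p" "card (\<xi> ` {..N}) > degree ?r"
    using assms by auto
qed

text \<open>The Lagrange basis sums to 1, whose derivative vanishes.\<close>

lemma diff_mat_row_sum: "(\<Sum>m\<le>N. diff_mat N \<xi> i m) = 0"
proof -
  have "1 = (\<Sum>j\<le>N. lagrange_poly N \<xi> j)" using lagrange_interpolation[of 1] by simp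
  from arg_cong[OF this, of "\<lambda>p. poly (pderiv p) (\<xi> i)"] show ?thesis
    by (simp add: higher_pderiv_sum[of 1, simplified] poly_sum diff_mat_poly)
qed

end

section \<open>Legendre-Gauss-Lobatto quadrature\<close>

locale lgl =
  fixes N :: nat and \<xi> :: "nat \<Rightarrow> real"
  assumes N: "N \<ge> 1" and lgl: "lgl_nodes N \<xi>"
begin

lemma strict_mono_nodes: "strict_mono_on {..N} \<xi>"
  and nodes_eq_roots: "\<xi> ` {..N} = {x. poly (lobatto N) x = 0}"
  using lgl by (simp_all only: lgl_nodes_def lobatto_def)

sublocale distinct_nodes
  by unfold_locales (rule strict_mono_on_imp_inj_on[OF strict_mono_nodes])

lemma node_less: "i < j \<Longrightarrow> j \<le> N \<Longrightarrow> \<xi> i < \<xi> j"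
  using strict_mono_nodes by (auto simp: strict_mono_on_def)

lemma lobatto_node: "i \<le> N \<Longrightarrow> poly (lobatto N) (\<xi> i) = 0"
  using nodes_eq_roots by blast

lemma node_bound: "i \<le> N \<Longrightarrow> \<bar>\<xi> i\<bar> \<le> 1"
  using lobatto_root_bound[OF N lobatto_node] .

lemma node_first: "\<xi> 0 = -1"
proof -
  have "poly (lobatto N) (-1) = 0" by (simp add: poly_lobatto)
  then have "-1 \<in> \<xi> ` {..N}" by (simp add: nodes_eq_roots)
  then obtain i where i: "i \<le> N" "\<xi> i = -1" by auto
  then have "i = 0" using node_less[of 0 i] node_bound[of 0] by fastforce
  with i show ?thesis by simp
qed

lemma node_last: "\<xi> N = 1"
proof -
  have "poly (lobatto N) 1 = 0" by (simp add: poly_lobatto)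
  then have "1 \<in> \<xi> ` {..N}" by (simp add: nodes_eq_roots)
  then obtain i where i: "i \<le> N" "\<xi> i = 1" by auto
  then have "i = N" using node_less[of i N] node_bound[of N] by fastforce
  with i show ?thesis by simp
qed

text \<open>Divide \<open>f\<close> by the nodal polynomial. The multiple of the nodal polynomial has integral zero by
  orthogonality and vanishes at the nodes; the remainder is reproduced by interpolation.\<close>

lemma quadrature_exact:
  assumes "degree f < 2 * N"
  shows "ref_integral f = (\<Sum>j\<le>N. quad_weight N \<xi> j * poly f (\<xi> j))"
proof -
  define q where "q = f div lobatto N"
  define r where "r = f mod lobatto N"
  have f: "f = lobatto N * q + r" by (simp add: q_def r_def)
  have dr: "degree r \<le> N"
    using degree_mod_less'[of "lobatto N" f] lobatto_nonzero[OF N] degree_lobatto[OF N]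
    by (cases "r = 0") (auto simp: r_def)
  have "q = 0 \<or> degree q + 1 < N"
  proof (cases "q = 0")
    case False
    have "Suc N + degree q = degree (f - r)"
      using False lobatto_nonzero[OF N] degree_lobatto[OF N] by (simp add: f degree_mult_eq)
    also have "\<dots> < 2 * N" using assms dr N by (intro degree_diff_less) auto
    finally show ?thesis by simp
  qed simp
  then have "ref_integral f = ref_integral r" by (subst f) (simp add: ref_integral_add lobatto_orthogonal)
  also have "\<dots> = (\<Sum>j\<le>N. quad_weight N \<xi> j * poly r (\<xi> j))"
    by (subst lagrange_interpolation[OF dr])
       (simp add: ref_integral_sum ref_integral_smult quad_weight_ref_integral mult.commute)
  also have "\<dots> = (\<Sum>j\<le>N. quad_weight N \<xi> j * poly f (\<xi> j))"
    by (intro sum.cong) (auto simp: f lobatto_node)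
  finally show ?thesis .
qed

text \<open>Apply the quadrature to a polynomial that is nonnegative on the interval and vanishes at every node
  but the \<open>j\<close>th. Interior nodes need double zeros, but simple zeros suffice at the end points, and
  this keeps the degree below \<open>2 N\<close>.\<close>

lemma quad_weight_pos:
  assumes j: "j \<le> N"
  shows "quad_weight N \<xi> j > 0"
proof -
  \<comment> \<open>\<open>g\<close> carries the interior zeros, to be squared; \<open>e\<close> carries the simple zeros at the end points.\<close>
  define I where "I = {..N} - {0, N, j}"
  define e :: "real poly" where
    "e = (if j = 0 then [:1, -1:] else if j = N then [:1, 1:] else [:1, 0, -1:])"
  define g where "g = (\<Prod>m\<in>I. [:- \<xi> m, 1:])"
  define f where "f = e * g\<^sup>2"
  have g0: "g \<noteq> 0" by (auto simp: g_def I_def)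
  have dg: "degree g = card I" by (simp add: g_def degree_prod_sum_eq)
  have "degree e + 2 * card I < 2 * N"
  proof (cases "j = 0 \<or> j = N")
    case True
    then have "{0, N, j} = {0, N}" by auto
    then have "card I = Suc N - 2" using N by (simp add: I_def card_Diff_subset)
    then show ?thesis using True N by (auto simp: e_def)
  next
    case False
    then have "card I = Suc N - 3" using N j by (simp add: I_def card_Diff_subset)
    then show ?thesis using False N j by (auto simp: e_def)
  qed
  then have df: "degree f < 2 * N"
    using g0 by (auto simp: f_def degree_mult_eq degree_power_eq dg e_def)
  have zero: "poly f (\<xi> m) = 0" if "m \<le> N" "m \<noteq> j" for m
  proof (cases "m \<in> I")
    case True
    then have "poly g (\<xi> m) = 0" by (auto simp: g_def poly_prod I_def)
    then show ?thesis by (simp add: f_def)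
  next
    case False
    then show ?thesis using that node_first node_last N
      by (auto simp: I_def f_def e_def)
  qed
  have e_nonneg: "poly e x \<ge> 0" if "\<bar>x\<bar> \<le> 1" for x
    using that abs_square_le_1[of x] by (auto simp: e_def power2_eq_square)
  have "ref_integral f > 0"
    by (rule ref_integral_pos) (auto simp: f_def e_nonneg g0, auto simp: e_def split: if_splits)
  also have "ref_integral f = quad_weight N \<xi> j * poly f (\<xi> j)"
    unfolding quadrature_exact[OF df] using j
    by (subst sum.mono_neutral_right[of _ "{j}"]) (auto simp: zero)
  finally have "quad_weight N \<xi> j * poly f (\<xi> j) > 0" .
  moreover have "poly f (\<xi> j) \<ge> 0" using e_nonneg[OF node_bound[OF j]] by (simp add: f_def)
  ultimately show ?thesis by (simp add: zero_less_mult_iff)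
qed

text \<open>The set of nodes is symmetric by parity, and a finite set has only one increasing enumeration.\<close>

lemma node_reflect:
  assumes "i \<le> N" shows "\<xi> (N - i) = - \<xi> i"
proof -
  have even: "poly (pderiv (legendre N)) (-x) = (-1) ^ Suc N * poly (pderiv (legendre N)) x" for x
  proof -
    have "poly (([:-1, 0, 1:] :: real poly) ^ N) (-x) = poly ([:-1, 0, 1:] ^ N) x" for x
      by (simp add: poly_power)
    from poly_pderiv_funpow_minus[OF this, of "Suc N" x] show ?thesis
      by (simp add: legendre_def pderiv_smult)
  qed
  have sym: "poly (lobatto N) (-x) = 0 \<longleftrightarrow> poly (lobatto N) x = 0" for x
    by (simp add: poly_lobatto even)
  define \<zeta> where "\<zeta> = (\<lambda>i. - \<xi> (N - i))"
  have img: "\<zeta> ` {..N} = \<xi> ` {..N}"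
  proof -
    have "\<zeta> ` {..N} = uminus ` \<xi> ` ((\<lambda>i. N - i) ` {..N})"
      by (simp add: \<zeta>_def image_image)
    also have "(\<lambda>i. N - i) ` {..N} = {..N}"
    proof
      show "{..N} \<subseteq> (\<lambda>i. N - i) ` {..N}"
      proof
        fix k assume "k \<in> {..N}"
        then have "k = N - (N - k)" "N - k \<in> {..N}" by auto
        then show "k \<in> (\<lambda>i. N - i) ` {..N}" by (rule image_eqI)
      qed
    qed auto
    also have "uminus ` \<xi> ` {..N} = \<xi> ` {..N}"
    proof (intro equalityI subsetI)
      fix x assume "x \<in> uminus ` \<xi> ` {..N}"
      then show "x \<in> \<xi> ` {..N}" unfolding nodes_eq_roots using sym by auto
    next
      fix x assume "x \<in> \<xi> ` {..N}"
      then have "- x \<in> \<xi> ` {..N}" unfolding nodes_eq_roots using sym by simp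
      then show "x \<in> uminus ` \<xi> ` {..N}" by (intro image_eqI[of _ _ "- x"]) simp_all
    qed
    finally show ?thesis .
  qed
  have "map \<zeta> [0..<Suc N] = map \<xi> [0..<Suc N]"
  proof (rule sorted_distinct_set_unique)
    have sorted: "sorted (map f [0..<Suc N])" and distinct: "distinct (map f [0..<Suc N])"
      if f: "\<And>i j. i < j \<Longrightarrow> j \<le> N \<Longrightarrow> f i < f j" for f :: "nat \<Rightarrow> real"
    proof -
      show "sorted (map f [0..<Suc N])"
        unfolding sorted_wrt_map sorted_wrt_iff_nth_less by (auto simp del: upt_Suc intro!: less_imp_le[OF f])
      have "inj_on f {0..<Suc N}"
        by (rule linorder_inj_onI) (use f in \<open>fastforce+\<close>)
      then show "distinct (map f [0..<Suc N])" by (simp add: distinct_map del: upt_Suc)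
    qed
    have "\<zeta> i < \<zeta> j" if "i < j" "j \<le> N" for i j
      using that by (auto simp: \<zeta>_def intro!: node_less)
    then show "sorted (map \<zeta> [0..<Suc N])" "distinct (map \<zeta> [0..<Suc N])"
      by (intro sorted distinct; assumption)+
    show "sorted (map \<xi> [0..<Suc N])" "distinct (map \<xi> [0..<Suc N])"
      by (intro sorted distinct node_less; assumption)+
    have "set [0..<Suc N] = {..N}" by auto
    then show "set (map \<zeta> [0..<Suc N]) = set (map \<xi> [0..<Suc N])"
      by (simp only: set_map img)
  qed
  then have "\<zeta> i = \<xi> i" using assms by (simp del: upt_Suc)
  then show ?thesis by (simp add: \<zeta>_def)
qed

text \<open>Two faces may be glued with a tangential direction reversed; this symmetry makes the quadrature
  weights on both sides agree.\<close>

lemma quad_weight_reflect: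
  assumes j: "j \<le> N" shows "quad_weight N \<xi> (N - j) = quad_weight N \<xi> j"
proof -
  have "lagrange N \<xi> (N - j) x = lagrange N \<xi> j (- x)" for x
  proof -
    have "lagrange N \<xi> (N - j) x = (\<Prod>m\<in>{..N} - {j}. (x - \<xi> (N - m)) / (\<xi> (N - j) - \<xi> (N - m)))"
      unfolding lagrange_def
      by (rule prod.reindex_bij_witness[of _ "\<lambda>m. N - m" "\<lambda>m. N - m"]) (use j in auto)
    also have "\<dots> = lagrange N \<xi> j (- x)"
      unfolding lagrange_def
    proof (rule prod.cong[OF refl])
      fix m assume "m \<in> {..N} - {j}"
      then have "(x - \<xi> (N - m)) / (\<xi> (N - j) - \<xi> (N - m)) = (x + \<xi> m) / (\<xi> m - \<xi> j)"
        using j by (simp add: node_reflect)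
      also have "\<dots> = (- x - \<xi> m) / (\<xi> j - \<xi> m)"
        by (subst minus_divide_divide[symmetric]) simp
      finally show "(x - \<xi> (N - m)) / (\<xi> (N - j) - \<xi> (N - m)) = (- x - \<xi> m) / (\<xi> j - \<xi> m)" .
    qed
    finally show ?thesis .
  qed
  then have "lagrange N \<xi> (N - j) = (\<lambda>x. lagrange N \<xi> j (- x))" by auto
  then show ?thesis
    using Henstock_Kurzweil_Integration.integral_reflect_real[of 1 "-1" "lagrange N \<xi> j"]
    by (simp add: quad_weight_def)
qed

text \<open>The two products are the exact quadratures of \<open>\<ell>\<^sub>m' \<ell>\<^sub>i\<close> and \<open>\<ell>\<^sub>i' \<ell>\<^sub>m\<close>, of degree at most \<open>2 N - 1\<close>, so
  their sum is the integral of the derivative of \<open>\<ell>\<^sub>i \<ell>\<^sub>m\<close>.\<close>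

lemma summation_by_parts:
  assumes "i \<le> N" "m \<le> N"
  shows "quad_weight N \<xi> i * diff_mat N \<xi> i m + quad_weight N \<xi> m * diff_mat N \<xi> m i
    = of_bool (i = N \<and> m = N) - of_bool (i = 0 \<and> m = 0)"
proof -
  have *: "quad_weight N \<xi> i * diff_mat N \<xi> i m
      = ref_integral (pderiv (lagrange_poly N \<xi> m) * lagrange_poly N \<xi> i)" if "i \<le> N" "m \<le> N" for i m
  proof -
    have "degree (pderiv (lagrange_poly N \<xi> m) * lagrange_poly N \<xi> i) \<le> (N - 1) + N"
      using degree_lagrange_poly[OF that(1), of \<xi>] degree_lagrange_poly[OF that(2), of \<xi>]
      by (intro order_trans[OF degree_mult_le] add_mono) (auto simp: degree_pderiv)
    also have "\<dots> < 2 * N" using N by simp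
    finally have "ref_integral (pderiv (lagrange_poly N \<xi> m) * lagrange_poly N \<xi> i)
        = (\<Sum>j\<le>N. quad_weight N \<xi> j * (diff_mat N \<xi> j m * of_bool (j = i)))"
      using that by (simp add: quadrature_exact poly_lagrange_poly lagrange_node diff_mat_poly)
    also have "\<dots> = quad_weight N \<xi> i * diff_mat N \<xi> i m"
      using that by (simp add: of_bool_def if_distrib cong: if_cong)
    finally show ?thesis ..
  qed
  have "ref_integral (pderiv (lagrange_poly N \<xi> m) * lagrange_poly N \<xi> i)
      + ref_integral (pderiv (lagrange_poly N \<xi> i) * lagrange_poly N \<xi> m)
      = lagrange N \<xi> m (\<xi> N) * lagrange N \<xi> i (\<xi> N) - lagrange N \<xi> m (\<xi> 0) * lagrange N \<xi> i (\<xi> 0)"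
    by (subst ref_integral_by_parts) (simp add: node_first node_last poly_lagrange_poly mult.commute)
  then show ?thesis
    using assms by (simp add: * lagrange_node) auto
qed

end

section \<open>The entropy conservative flux\<close>

text \<open>The entropy flux potential \<open>w \<cdot> f\<^sub>l - v\<^sub>l S + \<theta> B\<^sub>l\<close> in primitive variables, where \<open>\<theta>\<close> is the
  contraction of \<open>w\<close> with the non-conservative vector of the MHD equations.\<close>

definition entropy_potential :: "phys \<Rightarrow> state \<Rightarrow> real^3" where
  "entropy_potential P u = (\<chi> l. dens u * vel u $ l + beta P u * vel u $ l * (mag u \<bullet> mag u)
     + 2 * beta P u * glm_speed P * glm u * mag u $ l)"

definition godunov_scalar :: "phys \<Rightarrow> state \<Rightarrow> real" where
  "godunov_scalar P u = 2 * beta P u * (vel u \<bullet> mag u)"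

lemma entropy_vars_Phi_MHD:
  "entropy_vars P u \<bullet> Phi_MHD u = godunov_scalar P u"
  by (simp add: entropy_vars_def Phi_MHD_def godunov_scalar_def inner_commute algebra_simps)

text \<open>The GLM non-conservative term does no work on the entropy: its energy part and its \<open>\<psi>\<close> part cancel.\<close>

lemma entropy_vars_Phi_GLM: "entropy_vars P u \<bullet> Phi_GLM u $ l = 0"
  by (simp add: entropy_vars_def Phi_GLM_def)

lemma logmean_commute: "logmean a b = logmean b a"
  by (simp add: logmean_def) (metis minus_diff_eq minus_divide_divide)

lemma avg_commute: "avg a b = avg b a"
  by (simp add: avg_def add.commute)

lemma avg_same [simp]: "avg a a = a"
  by (simp add: avg_def flip: scaleR_2)

lemma ec_flux_commute: "ec_flux P a b = ec_flux P b a"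
  unfolding ec_flux_def Let_def
  by (simp only: avg_commute logmean_commute)

lemma logmean_ln:
  assumes "a > 0" "b > 0"
  shows "logmean a b * (ln b - ln a) = b - a"
  using assms by (auto simp: logmean_def)

lemma logmean_pos:
  assumes "a > 0" "b > 0"
  shows "logmean a b > 0"
  using assms by (auto simp: logmean_def zero_less_divide_iff)

lemma real_avg: "avg a b = (a + b) / (2::real)"
  by (simp add: avg_def)

lemma beta_pos: "dens u > 0 \<Longrightarrow> pressure P u > 0 \<Longrightarrow> beta P u > 0"
  by (simp add: beta_def)

lemma sum_avg_square: "(\<Sum>k\<in>UNIV. avg ((x $ k)\<^sup>2) ((y $ k)\<^sup>2)) = avg (x \<bullet> x) (y \<bullet> y)"
  for x y :: "real^'n"
  by (simp add: real_avg inner_vec_def power2_eq_square sum.distrib flip: sum_divide_distrib)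

text \<open>With the sums over components written as inner products, one computation covers all three
  directions \<open>l\<close>.\<close>

lemma ec_flux_nth:
  fixes P :: phys and a b :: state and l :: 3
  defines "v \<equiv> avg (vel a) (vel b)" and "B \<equiv> avg (mag a) (mag b)"
    and "q \<equiv> avg (glm a) (glm b)" and "\<rho> \<equiv> logmean (dens a) (dens b)"
    and "pt \<equiv> avg (dens a) (dens b) / (2 * avg (beta P a) (beta P b))
      + 1/2 * avg (mag a \<bullet> mag a) (mag b \<bullet> mag b)"
  defines "m \<equiv> (\<rho> * v $ l) *\<^sub>R v - B $ l *\<^sub>R B + pt *\<^sub>R axis l 1"
    and "G \<equiv> v $ l *\<^sub>R B - B $ l *\<^sub>R v + (glm_speed P * q) *\<^sub>R axis l 1"
  shows "ec_flux P a b $ l = (\<rho> * v $ l, m,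
     \<rho> * v $ l * (1 / (2 * (adiab P - 1) * logmean (beta P a) (beta P b))
        - 1/2 * avg (vel a \<bullet> vel a) (vel b \<bullet> vel b))
     + m \<bullet> v + G \<bullet> B + glm_speed P * B $ l * q
     - 1/2 * avg (vel a $ l * (mag a \<bullet> mag a)) (vel b $ l * (mag b \<bullet> mag b))
     + B $ l * avg (vel a \<bullet> mag a) (vel b \<bullet> mag b)
     - glm_speed P * avg (mag a $ l * glm a) (mag b $ l * glm b),
     G, glm_speed P * B $ l)"
proof -
  have 1: "(\<Sum>k\<in>UNIV. avg (x * (y $ k)\<^sup>2) (x' * (y' $ k)\<^sup>2)) = avg (x * (y \<bullet> y)) (x' * (y' \<bullet> y'))"
    for x x' and y y' :: "real^3"
    by (simp add: real_avg inner_vec_def power2_eq_square sum.distrib sum_distrib_left flip: sum_divide_distrib)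
  have 2: "(\<Sum>k\<in>UNIV. avg (x $ k * y $ k) (x' $ k * y' $ k)) = avg (x \<bullet> y) (x' \<bullet> y')"
    for x y x' y' :: "real^3"
    by (simp add: real_avg inner_vec_def sum.distrib flip: sum_divide_distrib)
  have m: "\<rho> * v $ l * v $ k - B $ l * B $ k + of_bool (l = k) * pt = m $ k" for k
    by (simp add: m_def axis_def eq_commute[of l])
  have G: "v $ l * B $ k - v $ k * B $ l + of_bool (l = k) * glm_speed P * q = G $ k" for k
    by (simp add: G_def axis_def eq_commute[of l])
  have v: "avg (vel a) (vel b) = v" "avg (mag a) (mag b) = B" "avg (glm a) (glm b) = q"
    "logmean (dens a) (dens b) = \<rho>"
    by (simp_all add: v_def B_def q_def \<rho>_def)
  have mv: "(\<chi> k. m $ k) = m" "(\<chi> k. G $ k) = G" by (simp_all add: vec_eq_iff)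
  have mi: "(\<Sum>k\<in>UNIV. m $ k * v $ k) = m \<bullet> v" "(\<Sum>k\<in>UNIV. G $ k * B $ k) = G \<bullet> B"
    by (simp_all add: inner_vec_def)
  show ?thesis
    unfolding ec_flux_def Let_def vec_lambda_beta sum_avg_square 1 2 v m[unfolded pt_def] G mv mi ..
qed

lemma ec_flux_consistent:
  assumes "adiab P > 1" "dens u > 0" "pressure P u > 0"
  shows "ec_flux P u u = adv_flux P u"
proof -
  have b: "2 * beta P u = dens u / pressure P u" by (simp add: beta_def)
  have p: "dens u / (2 * beta P u) = pressure P u" using assms by (simp add: b)
  have *: "x * (1 / (2 * k * (x / (2 * q)))) = q / k" if "x > 0" "q > 0" for x k q :: real
    using that by (cases "k = 0") (simp_all add: divide_simps)
  have e: "dens u * (1 / (2 * (adiab P - 1) * beta P u)) = pressure P u / (adiab P - 1)"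
    unfolding beta_def by (rule *[OF assms(2,3)])
  have a: "adiab P * pressure P u / (adiab P - 1) = pressure P u + pressure P u / (adiab P - 1)"
    using assms by (simp add: field_simps)
  define X where "X = 1 / (2 * (adiab P - 1) * beta P u)"
  define G where "G = pressure P u / (adiab P - 1)"
  note e = e[folded X_def G_def]
  have axis: "axis l 1 $ k = of_bool (l = k)" for l k :: 3 by (simp add: axis_def)
  show ?thesis
    unfolding vec_eq_iff[of "ec_flux P u u"] ec_flux_nth adv_flux_def Let_def avg_same
      logmean_def[of x x for x] if_P[OF refl] p X_def[symmetric] a G_def[symmetric] power2_norm_eq_inner
    by (simp add: vec_eq_iff axis inner_diff_left inner_add_left inner_axis' e[symmetric])
       (simp add: inner_commute[of "mag u" "vel u"] algebra_simps)
qed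

text \<open>The discrete form of \<open>dw \<cdot> f\<^sub>l = d\<Psi>\<^sub>l - B\<^sub>l d\<theta>\<close>. The logarithmic means turn jumps of logarithms in the
  first entropy variable into jumps of \<open>\<rho>\<close> and \<open>\<beta>\<close>; the mean pressure is \<open>{{\<rho>}} / (2 {{\<beta>}})\<close> because
  \<open>2 \<beta> p = \<rho>\<close>; everything else is the product rule \<open>[[x y]] = {{x}} [[y]] + {{y}} [[x]]\<close>.\<close>

lemma ec_flux_jump:
  assumes g: "adiab P > 1" and L: "dens a > 0" "pressure P a > 0"
    and R: "dens b > 0" "pressure P b > 0"
  shows "(entropy_vars P b - entropy_vars P a) \<bullet> (ec_flux P a b $ l)
    = entropy_potential P b $ l - entropy_potential P a $ l
      - avg (mag a) (mag b) $ l * (godunov_scalar P b - godunov_scalar P a)"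
proof -
  define rho where "rho = logmean (dens a) (dens b)"
  define bln where "bln = logmean (beta P a) (beta P b)"
  define lr where "lr = ln (dens b) - ln (dens a)"
  define bl where "bl = ln (beta P b) - ln (beta P a)"
  define pb where "pb = (dens a + dens b) / 2 / (beta P a + beta P b)"
  have bp: "beta P a > 0" "beta P b > 0" using L R beta_pos by auto
  have rho: "rho * lr = dens b - dens a" using L R by (simp add: rho_def lr_def logmean_ln)
  have bln: "bln * bl = beta P b - beta P a" "bln > 0"
    using bp by (simp_all add: bln_def bl_def logmean_ln logmean_pos)
  have pb: "pb * (beta P a + beta P b) = (dens a + dens b) / 2"
    using bp by (intro nonzero_eq_divide_eq[THEN iffD1, OF _ pb_def]) auto
  have s: "(adiab P - spec_entropy P u) / (adiab P - 1)
      = ln (dens u) + (adiab P + ln 2 + ln (beta P u)) / (adiab P - 1)"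
    if "dens u > 0" "pressure P u > 0" for u
    using g that
    by (simp add: spec_entropy_def beta_def ln_mult ln_div ln_powr field_simps)
  have w: "rho * ((adiab P - spec_entropy P b) / (adiab P - 1) - (adiab P - spec_entropy P a) / (adiab P - 1))
     = dens b - dens a + rho * bl / (adiab P - 1)"
    unfolding s[OF L] s[OF R] rho[symmetric] lr_def bl_def
    by (simp add: algebra_simps add_divide_distrib diff_divide_distrib)
  have "avg (dens a) (dens b) / (2 * avg (beta P a) (beta P b)) = pb"
    using bp by (simp add: pb_def real_avg field_simps)
  note fold1 = this bln_def[symmetric] rho_def[symmetric]
  define e where "e = 1 / (2 * (adiab P - 1) * bln)"
  note fold2 = e_def[symmetric]
  have e: "2 * (beta P b - beta P a) * e = bl / (adiab P - 1)"
  proof -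
    have "2 * (x * y) * (1 / (2 * k * x)) = y / k" if "x > 0" for x y k :: real
      using that by (cases "k = 0") (simp_all add: divide_simps)
    from this[OF bln(2)] show ?thesis by (simp only: e_def flip: bln(1))
  qed
  define Sa where "Sa = (adiab P - spec_entropy P a) / (adiab P - 1)"
  define Sb where "Sb = (adiab P - spec_entropy P b) / (adiab P - 1)"
  define E where "E = bl / (adiab P - 1)"
  \<comment> \<open>In terms of mean values and half jumps all averages and jumps are polynomials.\<close>
  have halves: "\<exists>m d. x = m - d \<and> y = m + d" for x y :: "'a :: real_vector"
    by (rule exI[of _ "(1/2) *\<^sub>R (x + y)"], rule exI[of _ "(1/2) *\<^sub>R (y - x)"])
       (simp add: scaleR_add_right scaleR_diff_right flip: scaleR_left.add)
  have avg_half: "avg (m - d) (m + d) = m" for m d :: "'a :: real_vector"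
    by (simp add: avg_def flip: scaleR_2)
  obtain v V where v: "vel a = v - V" "vel b = v + V" using halves[of "vel a" "vel b"] by blast
  obtain B C where B: "mag a = B - C" "mag b = B + C" using halves[of "mag a" "mag b"] by blast
  obtain q Q where q: "glm a = q - Q" "glm b = q + Q" using halves[of "glm a" "glm b"] by blast
  obtain r R where r: "dens a = r - R" "dens b = r + R" using halves[of "dens a" "dens b"] by blast
  obtain \<beta> \<delta> where \<beta>: "beta P a = \<beta> - \<delta>" "beta P b = \<beta> + \<delta>" using halves[of "beta P a" "beta P b"] by blast
  define pt where "pt = pb + 1/2 * (B \<bullet> B + C \<bullet> C)"
  define m where "m = (rho * v $ l) *\<^sub>R v - B $ l *\<^sub>R B + pt *\<^sub>R axis l 1"
  define c where "c = glm_speed P"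
  define G where "G = v $ l *\<^sub>R B - B $ l *\<^sub>R v + (c * q) *\<^sub>R axis l 1"
  define FE where "FE = rho * v $ l * (e - 1/2 * (v \<bullet> v + V \<bullet> V)) + m \<bullet> v + G \<bullet> B + c * B $ l * q
     - 1/2 * (v $ l * (B \<bullet> B + C \<bullet> C) + 2 * V $ l * (B \<bullet> C)) + B $ l * (v \<bullet> B + V \<bullet> C)
     - c * (B $ l * q + C $ l * Q)"
  have norm: "norm (x + y) ^ 2 = x \<bullet> x + 2 * (x \<bullet> y) + y \<bullet> y"
    "norm (x - y) ^ 2 = x \<bullet> x - 2 * (x \<bullet> y) + y \<bullet> y" for x y :: "real^3"
    by (simp_all add: power2_norm_eq_inner inner_diff_left inner_diff_right inner_add_left inner_add_right inner_commute)
  have prod: "avg ((x - x') \<bullet> (y - y')) ((x + x') \<bullet> (y + y')) = x \<bullet> y + x' \<bullet> y'" for x x' y y' :: "'b :: real_inner"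
    by (simp add: real_avg inner_diff_left inner_diff_right inner_add_left inner_add_right)
  have jump: "entropy_vars P b - entropy_vars P a
     = (Sb - Sa - (4 * \<beta> * (v \<bullet> V) + 2 * \<delta> * (v \<bullet> v + V \<bullet> V)), 4 *\<^sub>R (\<beta> *\<^sub>R V + \<delta> *\<^sub>R v), - 4 * \<delta>,
        4 *\<^sub>R (\<beta> *\<^sub>R C + \<delta> *\<^sub>R B), 4 * (\<beta> * Q + \<delta> * q))"
    unfolding entropy_vars_def Sa_def[symmetric] Sb_def[symmetric] v B q \<beta> norm
    by (simp add: vec_eq_iff) (simp add: algebra_simps)
  have triple: "avg ((x - x') * ((y - y') \<bullet> (y - y'))) ((x + x') * ((y + y') \<bullet> (y + y')))
     = x * (y \<bullet> y + y' \<bullet> y') + 2 * x' * (y \<bullet> y')" for x x' :: real and y y' :: "'b :: real_inner"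
    by (simp add: real_avg inner_diff_left inner_diff_right inner_add_left inner_add_right inner_commute algebra_simps)
  have flux: "ec_flux P a b $ l = (rho * v $ l, m, FE, G, c * B $ l)"
    unfolding ec_flux_nth fold1 fold2
    unfolding v B q avg_half prod vector_minus_component vector_add_component triple
    unfolding m_def G_def FE_def pt_def c_def using prod[of "B $ l" "C $ l" q Q] by simp
  have m: "x \<bullet> m = rho * v $ l * (x \<bullet> v) - B $ l * (x \<bullet> B) + pt * x $ l"
    and G: "x \<bullet> G = v $ l * (x \<bullet> B) - B $ l * (x \<bullet> v) + c * q * x $ l" for x
    by (simp_all add: m_def G_def inner_diff_right inner_add_right inner_axis)
  \<comment> \<open>All that the polynomial identity needs to know about the two logarithmic means and the mean
      pressure.\<close>
  have hyps: "rho * (Sb - Sa) = 2 * R + rho * E" "4 * \<delta> * e = E" "2 * \<beta> * pb = r"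
    using w e pb by (simp_all add: Sa_def Sb_def E_def r \<beta> ac_simps)
  show ?thesis
    unfolding jump flux
    by (simp add: m G FE_def pt_def entropy_potential_def godunov_scalar_def v B q r \<beta> avg_half
          c_def[symmetric] inner_add_left inner_diff_left inner_diff_right inner_add_right
          inner_commute[of m] inner_commute[of G] inner_commute[of B v] inner_commute[of C v]
          inner_commute[of C B] inner_commute[of V v])
       (use hyps in algebra)
qed

section \<open>Dissipation of the viscous flux\<close>

lemma bounded_linear_state_components:
  "bounded_linear dens" "bounded_linear mom" "bounded_linear energy" "bounded_linear mag" "bounded_linear glm"
  unfolding dens_def[abs_def] mom_def[abs_def] energy_def[abs_def] mag_def[abs_def] glm_def[abs_def]
  by (intro bounded_linear_fst_comp bounded_linear_snd_comp bounded_linear_ident)+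

lemmas state_component_derivatives [derivative_intros] =
  bounded_linear_state_components[THEN bounded_linear.has_derivative]

text \<open>The explicit inverse of the map to entropy variables on the half space where the third component
  \<open>- 2 \<beta>\<close> is negative. It shows that the inverse map is smooth, and it expresses velocity, magnetic field
  and temperature as simple quotients of entropy variables.\<close>

definition from_entropy_vars :: "phys \<Rightarrow> state \<Rightarrow> state" where
  "from_entropy_vars P w =
     (let b = - energy w / 2; v = (1 / (2 * b)) *\<^sub>R mom w; B = (1 / (2 * b)) *\<^sub>R mag w; \<psi> = glm w / (2 * b);
          s = adiab P - (adiab P - 1) * (dens w + b * (v \<bullet> v));
          \<rho> = exp (- (s + ln (2 * b)) / (adiab P - 1))
      in (\<rho>, \<rho> *\<^sub>R v, \<rho> / (2 * b) / (adiab P - 1) + 1/2 * \<rho> * (v \<bullet> v) + 1/2 * (B \<bullet> B) + 1/2 * \<psi>\<^sup>2, B, \<psi>))"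

lemma
  assumes g: "adiab P > 1" and w: "energy w < 0"
  shows from_entropy_vars_admissible: "from_entropy_vars P w \<in> admissible P"
    and entropy_vars_from: "entropy_vars P (from_entropy_vars P w) = w"
    and vel_from: "vel (from_entropy_vars P w) = (- 1 / energy w) *\<^sub>R mom w"
    and mag_from: "mag (from_entropy_vars P w) = (- 1 / energy w) *\<^sub>R mag w"
    and temperature_from: "pressure P (from_entropy_vars P w) / (gas_const P * dens (from_entropy_vars P w))
      = - 1 / (gas_const P * energy w)"
proof -
  define b where "b = - energy w / 2"
  define v where "v = (1 / (2 * b)) *\<^sub>R mom w"
  define s where "s = adiab P - (adiab P - 1) * (dens w + b * (v \<bullet> v))"
  define r where "r = exp (- (s + ln (2 * b)) / (adiab P - 1))"
  define u where "u = from_entropy_vars P w"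
  have b: "b > 0" and r: "r > 0" using w by (simp_all add: b_def r_def)
  have comp: "dens u = r" "mom u = r *\<^sub>R v" "mag u = (1 / (2 * b)) *\<^sub>R mag w" "glm u = glm w / (2 * b)"
    "energy u = r / (2 * b) / (adiab P - 1) + 1/2 * r * (v \<bullet> v) + 1/2 * (mag u \<bullet> mag u) + 1/2 * (glm u)\<^sup>2"
    by (simp_all add: u_def from_entropy_vars_def Let_def b_def v_def s_def r_def
        dens_def mom_def mag_def glm_def energy_def)
  have vel: "vel u = v" using r by (simp add: vel_def comp)
  have p: "pressure P u = r / (2 * b)"
    unfolding pressure_def power2_norm_eq_inner vel comp(5) comp(1) using g by simp
  show "from_entropy_vars P w \<in> admissible P"
    using b r by (simp add: admissible_def p comp flip: u_def)
  have beta: "beta P u = b" using r b by (simp add: beta_def p comp)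
  have s: "spec_entropy P u = s"
  proof -
    have "spec_entropy P u = (1 - adiab P) * ln r - ln (2 * b)"
      using r b by (simp add: spec_entropy_def p comp ln_mult ln_div ln_powr algebra_simps)
    also have "\<dots> = s" using g by (simp add: r_def field_simps)
    finally show ?thesis .
  qed
  have "(adiab P - spec_entropy P u) / (adiab P - 1) - beta P u * (norm (vel u))\<^sup>2 = dens w"
    using g by (simp add: s s_def beta vel power2_norm_eq_inner)
  then show "entropy_vars P (from_entropy_vars P w) = w"
    using b unfolding entropy_vars_def u_def[symmetric]
    by (simp add: beta vel prod_eq_iff v_def comp)
       (simp add: b_def dens_def mom_def mag_def glm_def energy_def)
  show "vel (from_entropy_vars P w) = (- 1 / energy w) *\<^sub>R mom w"
    using w by (simp add: vel v_def b_def flip: u_def)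
  show "mag (from_entropy_vars P w) = (- 1 / energy w) *\<^sub>R mag w"
    using w by (simp add: comp b_def flip: u_def)
  show "pressure P (from_entropy_vars P w) / (gas_const P * dens (from_entropy_vars P w))
      = - 1 / (gas_const P * energy w)"
    using r w by (simp add: comp p b_def flip: u_def)
qed

lemma cons_vars_eq:
  assumes "adiab P > 1" "energy w < 0"
  shows "cons_vars P w = from_entropy_vars P w"
  unfolding cons_vars_def
  using entropy_vars_inj from_entropy_vars_admissible entropy_vars_from assms
  by (intro inv_into_f_eq) auto

lemma cons_vars_entropy_vars:
  assumes "adiab P > 1" "dens u > 0" "pressure P u > 0"
  shows "cons_vars P (entropy_vars P u) = u"
  unfolding cons_vars_def using entropy_vars_inj assms by (intro inv_into_f_f) (auto simp: admissible_def)

lemma entropy_vars_components: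
  "mom (entropy_vars P u) = (2 * beta P u) *\<^sub>R vel u" "energy (entropy_vars P u) = - 2 * beta P u"
  "mag (entropy_vars P u) = (2 * beta P u) *\<^sub>R mag u" "glm (entropy_vars P u) = 2 * beta P u * glm u"
  by (simp_all add: entropy_vars_def mom_def energy_def mag_def glm_def)

lemma from_entropy_vars_differentiable:
  assumes "adiab P > 1" "energy w < 0"
  shows "from_entropy_vars P differentiable (at w)"
  unfolding differentiable_def from_entropy_vars_def Let_def
  using assms
  by - (rule exI, (rule derivative_intros | simp)+)

lemma energy_neg_eventually:
  assumes "energy w < 0"
  shows "\<forall>\<^sub>F x in nhds w. energy x < 0"
proof -
  have "isCont energy w"
    using bounded_linear_state_components(3) by (rule linear_continuous_at)
  then have "(energy \<longlongrightarrow> energy w) (nhds w)" by (simp add: continuous_at tendsto_at_iff_tendsto_nhds)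
  then show ?thesis using assms by (rule order_tendstoD)
qed

lemma cons_vars_differentiable:
  assumes "adiab P > 1" "energy w < 0"
  shows "cons_vars P differentiable (at w)"
proof -
  from from_entropy_vars_differentiable[OF assms]
  obtain D where "(from_entropy_vars P has_derivative D) (at w)" by (auto simp: differentiable_def)
  moreover have "\<forall>\<^sub>F x in at w. from_entropy_vars P x = cons_vars P x"
    using energy_neg_eventually[OF assms(2)] cons_vars_eq[OF assms(1)]
    by (auto simp: eventually_nhds_conv_at elim: eventually_mono)
  ultimately have "(cons_vars P has_derivative D) (at w)"
    by (rule has_derivative_transform_eventually) (simp_all add: cons_vars_eq assms)
  then show ?thesis by (auto simp: differentiable_def)
qed

text \<open>A derivative that passes through \<open>du_dw\<close> is a derivative with respect to the entropy variables, so
  only the formula \<open>r\<close> of the quantity in these variables has to be differentiated.\<close>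

lemma frechet_derivative_du_dw:
  assumes g: "adiab P > 1" and u: "dens u > 0" "pressure P u > 0"
    and f: "f differentiable (at u)"
    and r: "\<And>w. energy w < 0 \<Longrightarrow> f (from_entropy_vars P w) = r w"
    and r': "(r has_derivative r') (at (entropy_vars P u))"
  shows "frechet_derivative f (at u) (du_dw P u h) = r' h"
proof -
  define w where "w = entropy_vars P u"
  have w: "energy w < 0" using u by (simp add: w_def entropy_vars_components beta_def)
  have uw: "cons_vars P w = u" by (simp add: w_def cons_vars_entropy_vars g u)
  have "(cons_vars P has_derivative du_dw P u) (at w)"
    unfolding du_dw_def w_def[symmetric]
    using cons_vars_differentiable[OF g w] by (simp add: frechet_derivative_works)
  moreover have "(f has_derivative frechet_derivative f (at u)) (at u)"
    using f by (simp add: frechet_derivative_works)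
  ultimately have "((f \<circ> cons_vars P) has_derivative frechet_derivative f (at u) \<circ> du_dw P u) (at w)"
    by (intro diff_chain_at) (simp_all add: uw)
  moreover have "\<forall>\<^sub>F x in at w. (f \<circ> cons_vars P) x = r x"
    using energy_neg_eventually[OF w] cons_vars_eq[OF g] r
    by (auto simp: eventually_nhds_conv_at elim!: eventually_mono)
  ultimately have "(r has_derivative frechet_derivative f (at u) \<circ> du_dw P u) (at w)"
    by (rule has_derivative_transform_eventually) (simp_all add: cons_vars_eq g w r)
  then show ?thesis
    using has_derivative_unique[OF _ r'[folded w_def]] by (metis comp_apply)
qed


text \<open>Differentiate \<open>v\<^sub>k = - w\<^sub>k / w\<^sub>E\<close>, the analogous quotient for the magnetic field, and the temperature
  \<open>- 1 / (R w\<^sub>E)\<close>, where \<open>w\<^sub>E = - 2 \<beta>\<close> is the energy component of the entropy variables.\<close>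

lemma entropy_var_derivatives:
  assumes g: "adiab P > 1" and u: "dens u > 0" "pressure P u > 0"
  shows "frechet_derivative (\<lambda>u. vel u $ k) (at u) (du_dw P u h)
      = (mom h $ k + vel u $ k * energy h) / (2 * beta P u)"
    and "frechet_derivative (\<lambda>u. mag u $ k) (at u) (du_dw P u h)
      = (mag h $ k + mag u $ k * energy h) / (2 * beta P u)"
    and "gas_const P \<noteq> 0 \<Longrightarrow>
      frechet_derivative (\<lambda>u. pressure P u / (gas_const P * dens u)) (at u) (du_dw P u h)
      = energy h / (4 * (beta P u)\<^sup>2 * gas_const P)"
proof -
  define w where "w = entropy_vars P u"
  have b: "beta P u > 0" using u by (simp add: beta_def)
  have w: "energy w = - 2 * beta P u" "energy w \<noteq> 0"
    "mom w = (2 * beta P u) *\<^sub>R vel u" "mag w = (2 * beta P u) *\<^sub>R mag u"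
    using b by (simp_all add: w_def entropy_vars_components)
  have nth: "((\<lambda>x. f x $ k) has_derivative (\<lambda>h. f' h $ k)) F"
    if "(f has_derivative f') F" for f :: "state \<Rightarrow> real^3" and f' F k
    using bounded_linear.has_derivative[OF bounded_linear_vec_nth that] .
  note intros = nth derivative_intros
  have quotient: "((\<lambda>w. - f w $ k / energy w) has_derivative
      (\<lambda>h. (f h $ k + f w $ k / (2 * beta P u) * energy h) / (2 * beta P u))) (at w)"
    if "bounded_linear f" for f :: "state \<Rightarrow> real^3"
    by (rule has_derivative_eq_rhs, (rule intros bounded_linear.has_derivative[OF that] | fact w(2))+)
       (use b in \<open>simp add: w fun_eq_iff field_simps power2_eq_square\<close>)
  have vel_diff: "vel differentiable (at u)"
    unfolding differentiable_def vel_def[abs_def]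
    using u by - (rule exI, (rule derivative_intros | simp)+)
  then have "(\<lambda>u. vel u $ k) differentiable (at u)"
    unfolding differentiable_def using nth by blast
  from frechet_derivative_du_dw[OF g u this _ quotient[folded w_def, OF bounded_linear_state_components(2), unfolded w_def]]
  show "frechet_derivative (\<lambda>u. vel u $ k) (at u) (du_dw P u h)
      = (mom h $ k + vel u $ k * energy h) / (2 * beta P u)"
    using b by (simp add: vel_from g entropy_vars_components)
  have "(\<lambda>u. mag u $ k) differentiable (at u)"
    unfolding differentiable_def using nth state_component_derivatives(4) has_derivative_ident by blast
  from frechet_derivative_du_dw[OF g u this _ quotient[OF bounded_linear_state_components(4), unfolded w_def]]
  show "frechet_derivative (\<lambda>u. mag u $ k) (at u) (du_dw P u h)
      = (mag h $ k + mag u $ k * energy h) / (2 * beta P u)"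
    using b by (simp add: mag_from g entropy_vars_components)
  assume R: "gas_const P \<noteq> 0"
  have "(\<lambda>u. pressure P u / (gas_const P * dens u)) differentiable (at u)"
    unfolding differentiable_def pressure_def[abs_def] power2_norm_eq_inner vel_def[abs_def]
    using u R by - (rule exI, (rule derivative_intros | simp)+)
  moreover have "((\<lambda>w. - 1 / (gas_const P * energy w)) has_derivative
      (\<lambda>h. energy h / (4 * (beta P u)\<^sup>2 * gas_const P))) (at w)"
  proof -
    have "((\<lambda>y. - 1 / (gas_const P * y)) has_real_derivative 1 / (4 * (beta P u)\<^sup>2 * gas_const P))
        (at (energy w))"
      using R w(2) by (auto intro!: derivative_eq_intros simp: w(1) divide_simps power2_eq_square)
    from DERIV_compose_FDERIV[OF this bounded_linear_state_components(3)[THEN bounded_linear_imp_has_derivative]]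
    show ?thesis by simp
  qed
  ultimately show "frechet_derivative (\<lambda>u. pressure P u / (gas_const P * dens u)) (at u) (du_dw P u h)
      = energy h / (4 * (beta P u)\<^sup>2 * gas_const P)"
    unfolding w_def
    by (intro frechet_derivative_du_dw[OF g u,
          where f = "\<lambda>u. pressure P u / (gas_const P * dens u)"
            and r = "\<lambda>w. - 1 / (gas_const P * energy w)"
            and r' = "\<lambda>h. energy h / (4 * (beta P u)\<^sup>2 * gas_const P)"])
      (simp_all only: temperature_from[OF g])
qed

text \<open>The off-diagonal entries contribute the squared shear rates. On the diagonal, removing the trace
  leaves the squared differences of the three stretching rates.\<close>

lemma viscous_stress_nonneg:
  fixes d :: "3 \<Rightarrow> 3 \<Rightarrow> real"
  shows "(\<Sum>l\<in>UNIV. \<Sum>k\<in>UNIV. ((d l k + d k l) - 2/3 * (\<Sum>q\<in>UNIV. d q q) * of_bool (l = k)) * d l k) \<ge> 0"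
proof -
  have "(\<Sum>l\<in>UNIV. \<Sum>k\<in>UNIV. ((d l k + d k l) - 2/3 * (\<Sum>q\<in>UNIV. d q q) * of_bool (l = k)) * d l k)
    = (d 1 2 + d 2 1)\<^sup>2 + (d 1 3 + d 3 1)\<^sup>2 + (d 2 3 + d 3 2)\<^sup>2
      + 2/3 * ((d 1 1 - d 2 2)\<^sup>2 + (d 1 1 - d 3 3)\<^sup>2 + (d 2 2 - d 3 3)\<^sup>2)"
    by (simp add: sum_3 power2_eq_square field_simps)
  then show ?thesis by simp
qed

lemma resistive_nonneg:
  fixes d :: "3 \<Rightarrow> 3 \<Rightarrow> real"
  shows "(\<Sum>l\<in>UNIV. \<Sum>k\<in>UNIV. (d l k - d k l) * d l k) \<ge> 0"
proof -
  have "(\<Sum>l\<in>UNIV. \<Sum>k\<in>UNIV. (d l k - d k l) * d l k)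
    = (d 1 2 - d 2 1)\<^sup>2 + (d 1 3 - d 3 1)\<^sup>2 + (d 2 3 - d 3 2)\<^sup>2"
    by (simp add: sum_3 power2_eq_square field_simps)
  then show ?thesis by simp
qed

text \<open>The identity \<open>(curl B) \<times> B = (B \<cdot> \<nabla>) B - \<nabla> (|B|\<^sup>2 / 2)\<close> in components.\<close>

lemma cross3_curl_nth: "cross3 (curl_of d) B $ l = (\<Sum>k\<in>UNIV. B $ k * (d k l - d l k))"
  using exhaust_3[of l]
  by (elim disjE; simp only:; simp add: cross3_def curl_of_def sum_3 algebra_simps)

text \<open>Written with the gradients of velocity, magnetic field and temperature, the momentum and magnetic
  parts of \<open>q\<close> contain the energy part \<open>\<theta>\<close> times \<open>v\<close> and \<open>B\<close>. These pieces cancel against the work of the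
  viscous stress and the resistive energy flux. What is left is viscous friction, heat conduction
  and resistive heating, each a nonnegative quadratic form.\<close>

lemma visc_nodal_dissipative:
  assumes P: "phys_ok P" and u: "dens u > 0" "pressure P u > 0"
  shows "q \<bullet> visc_nodal P u q \<ge> 0"
proof -
  define b where "b = beta P u"
  define v where "v = (\<lambda>l k. (mom (q $ l) $ k + vel u $ k * energy (q $ l)) / (2 * b))"
  define B where "B = (\<lambda>l k. (mag (q $ l) $ k + mag u $ k * energy (q $ l)) / (2 * b))"
  define \<tau> where "\<tau> = (\<lambda>l k. (v l k + v k l) - 2/3 * (\<Sum>q\<in>UNIV. v q q) * of_bool (l = k))"
  define \<theta> where "\<theta> = (\<lambda>l. energy (q $ l))"
  have \<theta>: "\<theta> l = energy (q $ l)" for l by (simp add: \<theta>_def)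
  have g: "adiab P > 1" and R: "gas_const P > 0" and b: "b > 0"
    using P u by (simp_all add: phys_ok_def b_def beta_def)
  have mom: "mom (q $ l) $ k = 2 * b * v l k - vel u $ k * \<theta> l" for l k
    using b by (simp add: v_def \<theta>_def)
  have mag: "mag (q $ l) $ k = 2 * b * B l k - mag u $ k * \<theta> l" for l k
    using b by (simp add: B_def \<theta>_def)
  have pd: "pd_of (\<lambda>u. vel u $ k) u (\<chi> l. du_dw P u (q $ l)) l = v l k"
    "pd_of (\<lambda>u. mag u $ k) u (\<chi> l. du_dw P u (q $ l)) l = B l k"
    "pd_of (\<lambda>u. pressure P u / (gas_const P * dens u)) u (\<chi> l. du_dw P u (q $ l)) l
      = \<theta> l / (4 * b\<^sup>2 * gas_const P)" for l k
    using entropy_var_derivatives[OF g u] R by (simp_all add: pd_of_def v_def B_def b_def \<theta>_def)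
  have flux: "visc_nodal P u q $ l = (0, (\<chi> k. mu_NS P * \<tau> l k),
      (\<Sum>k\<in>UNIV. mu_NS P * \<tau> l k * vel u $ k) + heat_cond P * (\<theta> l / (4 * b\<^sup>2 * gas_const P))
        - mu_R P * (\<Sum>k\<in>UNIV. mag u $ k * (B k l - B l k)),
      (\<chi> k. mu_R P * (B l k - B k l)), 0)" for l
    unfolding visc_nodal_def visc_flux_def Let_def pd vec_lambda_beta cross3_curl_nth
    by (simp add: \<tau>_def algebra_simps)
  have comp: "x \<bullet> (0, m, e, c, 0) = mom x \<bullet> m + energy x * e + mag x \<bullet> c" for x :: state and m e c
    by (simp add: inner_prod_def mom_def energy_def mag_def)
  have "q $ l \<bullet> visc_nodal P u q $ l = 2 * b * mu_NS P * (\<Sum>k\<in>UNIV. \<tau> l k * v l k)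
      + heat_cond P / (4 * b\<^sup>2 * gas_const P) * (\<theta> l)\<^sup>2
      + 2 * b * mu_R P * (\<Sum>k\<in>UNIV. (B l k - B k l) * B l k)" for l
    unfolding flux comp
    by (simp add: inner_vec_def mom mag \<theta>[symmetric] sum_3 power2_eq_square algebra_simps)
  then have "q \<bullet> visc_nodal P u q = 2 * b * mu_NS P * (\<Sum>l\<in>UNIV. \<Sum>k\<in>UNIV. \<tau> l k * v l k)
      + heat_cond P / (4 * b\<^sup>2 * gas_const P) * (\<Sum>l\<in>UNIV. (\<theta> l)\<^sup>2)
      + 2 * b * mu_R P * (\<Sum>l\<in>UNIV. \<Sum>k\<in>UNIV. (B l k - B k l) * B l k)"
    by (simp add: inner_vec_def[of q] sum.distrib sum_distrib_left)
  moreover have "(\<Sum>l\<in>UNIV. \<Sum>k\<in>UNIV. \<tau> l k * v l k) \<ge> 0"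
    unfolding \<tau>_def by (rule viscous_stress_nonneg)
  moreover have "(\<Sum>l\<in>UNIV. (\<theta> l)\<^sup>2) \<ge> 0" by (intro sum_nonneg) simp
  ultimately show ?thesis
    using P b resistive_nonneg[of B] by (simp add: phys_ok_def)
qed

section \<open>Tensor-product summation by parts\<close>

lemma nodes_eq_PiE: "nodes N = PiE UNIV (\<lambda>_. {..N})"
  by (auto simp: nodes_def PiE_def Pi_def)

lemma finite_nodes [simp]: "finite (nodes N)"
  unfolding nodes_eq_PiE by (intro finite_PiE) auto

lemma finite_face_nodes [simp]: "finite (face_nodes N f)"
  by (simp add: face_nodes_def)

lemma nodes_update [simp]: "x \<in> nodes N \<Longrightarrow> m \<le> N \<Longrightarrow> x(d := m) \<in> nodes N"
  by (auto simp: nodes_def)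

lemma nodes_le [simp]: "x \<in> nodes N \<Longrightarrow> x d \<le> N"
  by (simp add: nodes_def)

lemma face_nodes_in_nodes: "x \<in> face_nodes N f \<Longrightarrow> x \<in> nodes N"
  by (simp add: face_nodes_def)

definition face_weight :: "nat \<Rightarrow> (nat \<Rightarrow> real) \<Rightarrow> 3 \<Rightarrow> node \<Rightarrow> real" where
  "face_weight N \<xi> d x = (\<Prod>e\<in>UNIV - {d}. quad_weight N \<xi> (x e))"

lemma weight3_face_weight: "weight3 N \<xi> x = quad_weight N \<xi> (x d) * face_weight N \<xi> d x"
  unfolding weight3_def face_weight_def by (rule prod.remove) auto

lemma face_weight_update [simp]: "face_weight N \<xi> d (x(d := m)) = face_weight N \<xi> d x"
  unfolding face_weight_def by (rule prod.cong) auto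

text \<open>Twice this form is the tested split-form derivative in direction \<open>d\<close> when \<open>G x y\<close> is the two-point
  flux between \<open>x\<close> and \<open>y\<close> contracted with the test function at \<open>x\<close>.\<close>

definition line_form :: "nat \<Rightarrow> (nat \<Rightarrow> real) \<Rightarrow> 3 \<Rightarrow> (node \<Rightarrow> node \<Rightarrow> real) \<Rightarrow> real" where
  "line_form N \<xi> d G =
     (\<Sum>x\<in>nodes N. weight3 N \<xi> x * (\<Sum>m\<le>N. diff_mat N \<xi> (x d) m * G x (x(d := m))))"

definition boundary :: "nat \<Rightarrow> (nat \<Rightarrow> real) \<Rightarrow> 3 \<Rightarrow> (node \<Rightarrow> real) \<Rightarrow> real" where
  "boundary N \<xi> d g = (\<Sum>x\<in>face_nodes N (d, True). face_weight N \<xi> d x * g x)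
     - (\<Sum>x\<in>face_nodes N (d, False). face_weight N \<xi> d x * g x)"

lemma line_form_add: "line_form N \<xi> d (\<lambda>x y. F x y + G x y) = line_form N \<xi> d F + line_form N \<xi> d G"
  by (simp add: line_form_def sum.distrib distrib_left)

lemma line_form_cmult: "line_form N \<xi> d (\<lambda>x y. c * G x y) = c * line_form N \<xi> d G"
  by (simp add: line_form_def sum_distrib_left ac_simps)

lemma line_form_diff: "line_form N \<xi> d (\<lambda>x y. F x y - G x y) = line_form N \<xi> d F - line_form N \<xi> d G"
  using line_form_add[of N \<xi> d F "\<lambda>x y. (-1) * G x y"] by (simp only: line_form_cmult) simp

lemma line_form_cong:
  assumes "\<And>x m. x \<in> nodes N \<Longrightarrow> m \<le> N \<Longrightarrow> F x (x(d := m)) = G x (x(d := m))"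
  shows "line_form N \<xi> d F = line_form N \<xi> d G"
  unfolding line_form_def using assms by (intro sum.cong arg_cong2[of _ _ _ _ "(*)"]) auto

lemma boundary_add: "boundary N \<xi> d (\<lambda>x. f x + g x) = boundary N \<xi> d f + boundary N \<xi> d g"
  by (simp add: boundary_def sum.distrib distrib_left)

lemma boundary_cmult: "boundary N \<xi> d (\<lambda>x. c * g x) = c * boundary N \<xi> d g"
  by (simp add: boundary_def sum_distrib_left right_diff_distrib ac_simps)

lemma boundary_diff: "boundary N \<xi> d (\<lambda>x. f x - g x) = boundary N \<xi> d f - boundary N \<xi> d g"
  using boundary_add[of N \<xi> d f "\<lambda>x. (-1) * g x"] by (simp only: boundary_cmult) simp

lemma boundary_cong:
  assumes "\<And>x. x \<in> nodes N \<Longrightarrow> f x = g x"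
  shows "boundary N \<xi> d f = boundary N \<xi> d g"
  unfolding boundary_def using assms face_nodes_in_nodes
  by (intro arg_cong2[of _ _ _ _ "(-)"] sum.cong) auto

text \<open>Exchanging the two ends of a grid segment, \<open>(x, m) \<mapsto> (x(d := m), x d)\<close>, is an involution.\<close>

lemma sum_node_pairs_swap:
  fixes h :: "node \<Rightarrow> node \<Rightarrow> real"
  shows "(\<Sum>x\<in>nodes N. \<Sum>m\<le>N. h x (x(d := m))) = (\<Sum>x\<in>nodes N. \<Sum>m\<le>N. h (x(d := m)) x)"
  unfolding sum.cartesian_product
  by (rule sum.reindex_bij_witness[of _ "\<lambda>(x, m). (x(d := m), x d)" "\<lambda>(x, m). (x(d := m), x d)"]) auto

context lgl
begin

lemma weight3_pos: "x \<in> nodes N \<Longrightarrow> weight3 N \<xi> x > 0"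
  unfolding weight3_def by (intro prod_pos) (auto intro: quad_weight_pos)

lemma line_form_row: "line_form N \<xi> d (\<lambda>x y. g x) = 0"
  by (simp add: line_form_def diff_mat_row_sum flip: sum_distrib_right)

text \<open>Summation by parts on every grid line in direction \<open>d\<close>. The weights of the two transverse directions
  are constant along the line and become the quadrature weights on its two end faces.\<close>

lemma line_form_transpose:
  "line_form N \<xi> d G + line_form N \<xi> d (\<lambda>x y. G y x) = boundary N \<xi> d (\<lambda>x. G x x)"
proof -
  define q where "q = (\<lambda>x y. weight3 N \<xi> x * diff_mat N \<xi> (x d) (y d))"
  have q: "line_form N \<xi> d G = (\<Sum>x\<in>nodes N. \<Sum>m\<le>N. q x (x(d := m)) * G x (x(d := m)))" for G
    by (simp add: line_form_def q_def sum_distrib_left mult.assoc)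
  have sbp: "q x (x(d := m)) + q (x(d := m)) x
      = face_weight N \<xi> d x * (of_bool (x d = N \<and> m = N) - of_bool (x d = 0 \<and> m = 0))"
    if "x \<in> nodes N" "m \<le> N" for x m
  proof -
    have "q x (x(d := m)) + q (x(d := m)) x = face_weight N \<xi> d x *
       (quad_weight N \<xi> (x d) * diff_mat N \<xi> (x d) m + quad_weight N \<xi> m * diff_mat N \<xi> m (x d))"
      by (simp add: q_def weight3_face_weight[of N \<xi> _ d] algebra_simps)
    then show ?thesis using that by (simp add: summation_by_parts)
  qed
  have "line_form N \<xi> d G + line_form N \<xi> d (\<lambda>x y. G y x)
      = (\<Sum>x\<in>nodes N. \<Sum>m\<le>N. (q x (x(d := m)) + q (x(d := m)) x) * G x (x(d := m)))"
    unfolding q sum_node_pairs_swap[of "\<lambda>x y. q x y * G y x"]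
    by (simp add: distrib_right sum.distrib)
  also have "\<dots> = (\<Sum>x\<in>nodes N. face_weight N \<xi> d x * G x x * (of_bool (x d = N) - of_bool (x d = 0)))"
  proof (rule sum.cong[OF refl])
    fix x assume x: "x \<in> nodes N"
    have pick: "(\<Sum>m\<le>N. of_bool (x d = k \<and> m = k) * G x (x(d := m))) = of_bool (x d = k) * G x x"
      if "k \<le> N" for k
    proof -
      have "(\<Sum>m\<le>N. of_bool (x d = k \<and> m = k) * G x (x(d := m)))
          = (\<Sum>m\<in>{k}. of_bool (x d = k \<and> m = k) * G x (x(d := m)))"
        using that by (intro sum.mono_neutral_right) auto
      also have "\<dots> = of_bool (x d = k) * G x (x(d := k))"
        by (simp only: sum.insert finite.emptyI empty_iff not_False_eq_True sum.empty add_0_right simp_thms)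
      also have "\<dots> = of_bool (x d = k) * G x x" by (cases "x d = k") auto
      finally show ?thesis .
    qed
    have "(\<Sum>m\<le>N. (q x (x(d := m)) + q (x(d := m)) x) * G x (x(d := m)))
        = face_weight N \<xi> d x * ((\<Sum>m\<le>N. of_bool (x d = N \<and> m = N) * G x (x(d := m)))
          - (\<Sum>m\<le>N. of_bool (x d = 0 \<and> m = 0) * G x (x(d := m))))"
      unfolding sum_subtractf[symmetric] sum_distrib_left
      using x by (intro sum.cong) (auto simp: sbp)
    then show "(\<Sum>m\<le>N. (q x (x(d := m)) + q (x(d := m)) x) * G x (x(d := m)))
        = face_weight N \<xi> d x * G x x * (of_bool (x d = N) - of_bool (x d = 0))"
      by (simp only: pick order.refl zero_le) (simp add: algebra_simps)
  qed
  also have "\<dots> = boundary N \<xi> d (\<lambda>x. G x x)"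
  proof -
    have "(\<Sum>x\<in>face_nodes N (d, b). face_weight N \<xi> d x * G x x)
       = (\<Sum>x\<in>nodes N. face_weight N \<xi> d x * G x x * of_bool (x d = (if b then N else 0)))" for b
      by (rule sum.mono_neutral_cong_left) (auto simp: face_nodes_def)
    then show ?thesis
      by (simp add: boundary_def right_diff_distrib sum_subtractf)
  qed
  finally show ?thesis .
qed

lemma line_form_column: "line_form N \<xi> d (\<lambda>x y. g y) = boundary N \<xi> d g"
  using line_form_transpose[of d "\<lambda>x y. g y"] by (simp add: line_form_row)

lemma line_form_symmetric:
  assumes "\<And>x y. G x y = G y x"
  shows "2 * line_form N \<xi> d G = boundary N \<xi> d (\<lambda>x. G x x)"
proof -
  have "(\<lambda>x y. G y x) = G" using assms by (intro ext)
  then show ?thesis using line_form_transpose[of d G] by simp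
qed

text \<open>Expanding the averages, the products with both factors at one node give half the boundary term, and
  the mixed products give the other half and a form in which \<open>A\<close> is differentiated and \<open>X\<close> is not.
  When \<open>A\<close> is a metric term, the metric identities apply to that form.\<close>

lemma line_form_skew_product:
  fixes X A :: "node \<Rightarrow> real^3"
  shows "line_form N \<xi> d (\<lambda>x y. (X y - X x) \<bullet> avg (A x) (A y))
    = boundary N \<xi> d (\<lambda>x. X x \<bullet> A x) - line_form N \<xi> d (\<lambda>x y. X x \<bullet> A y)"
proof -
  have "(X y - X x) \<bullet> avg (A x) (A y)
      = 1/2 * ((X y \<bullet> A y - X x \<bullet> A x) + (X y \<bullet> A x - X x \<bullet> A y))" for x y
    by (simp add: avg_def inner_diff_left inner_add_right algebra_simps)
  moreover have "line_form N \<xi> d (\<lambda>x y. X y \<bullet> A x)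
      = boundary N \<xi> d (\<lambda>x. X x \<bullet> A x) - line_form N \<xi> d (\<lambda>x y. X x \<bullet> A y)"
    using line_form_transpose[of d "\<lambda>x y. X x \<bullet> A y"] by simp
  ultimately show ?thesis
    by (simp only: line_form_cmult line_form_add line_form_diff line_form_row line_form_column) simp
qed

end

section \<open>Tensor-product interpolation\<close>

context distinct_nodes
begin

lemma prod_lagrange_node:
  assumes "x \<in> nodes N" "z \<in> nodes N"
  shows "(\<Prod>e\<in>S. lagrange N \<xi> (z e) (node_pt \<xi> x $ e)) = of_bool (\<forall>e\<in>S. z e = x e)"
proof -
  have "(\<Prod>e\<in>S. lagrange N \<xi> (z e) (node_pt \<xi> x $ e)) = (\<Prod>e\<in>S. of_bool (x e = z e))"
    using assms by (intro prod.cong) (auto simp: node_pt_def lagrange_node)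
  also have "\<dots> = of_bool (\<forall>e\<in>S. z e = x e)"
  proof (cases "\<forall>e\<in>S. z e = x e")
    case False
    then obtain e where "e \<in> S" "of_bool (x e = z e) = (0::real)" by auto
    then have "(\<Prod>e\<in>S. of_bool (x e = z e)) = (0::real)" by (intro prod_zero) auto
    then show ?thesis using False by simp
  qed simp
  finally show ?thesis .
qed

lemma interp_node:
  fixes f :: "node \<Rightarrow> 'a :: real_vector"
  assumes "x \<in> nodes N"
  shows "interp N \<xi> f (node_pt \<xi> x) = f x"
proof -
  have "interp N \<xi> f (node_pt \<xi> x) = (\<Sum>z\<in>nodes N. of_bool (\<forall>e. z e = x e) *\<^sub>R f z)"
    unfolding interp_def using assms by (intro sum.cong) (auto simp: prod_lagrange_node)
  also have "\<dots> = (\<Sum>z\<in>{x}. of_bool (\<forall>e. z e = x e) *\<^sub>R f z)"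
    using assms by (intro sum.mono_neutral_right) (auto simp: fun_eq_iff)
  finally show ?thesis by simp
qed

text \<open>Differentiating one Lagrange factor leaves Kronecker deltas in the other two directions, so only the
  nodes on the grid line through \<open>x\<close> contribute.\<close>

lemma pd_interp_node:
  fixes f :: "node \<Rightarrow> 'a :: real_normed_vector"
  assumes x: "x \<in> nodes N"
  shows "pd d (interp N \<xi> f) (node_pt \<xi> x) = (\<Sum>m\<le>N. diff_mat N \<xi> (x d) m *\<^sub>R f (x(d := m)))"
proof -
  define y where "y = node_pt \<xi> x"
  define L where "L = (\<lambda>z e. lagrange N \<xi> (z e) (y $ e))"
  define L' where "L' = (\<lambda>z e. deriv (lagrange N \<xi> (z e)) (y $ e))"
  have factor: "((\<lambda>y. lagrange N \<xi> (z e) (y $ e)) has_derivative (\<lambda>h. h $ e * L' z e)) (at y)" for z e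
    unfolding L'_def
    by (rule DERIV_compose_FDERIV[where f = "lagrange N \<xi> (z e)" and g = "\<lambda>y. y $ e",
          OF lagrange_has_derivative bounded_linear_imp_has_derivative[OF bounded_linear_vec_nth]])
  have D: "(interp N \<xi> f has_derivative
      (\<lambda>h. \<Sum>z\<in>nodes N. (\<Sum>e\<in>UNIV. h $ e * L' z e * (\<Prod>j\<in>UNIV - {e}. L z j)) *\<^sub>R f z)) (at y)"
    unfolding interp_def[abs_def] L_def
    by (rule has_derivative_sum, rule has_derivative_scaleR_left, rule has_derivative_prod, rule factor)
  have "pd d (interp N \<xi> f) y
      = (\<Sum>z\<in>nodes N. (\<Sum>e\<in>UNIV. axis d 1 $ e * L' z e * (\<Prod>j\<in>UNIV - {e}. L z j)) *\<^sub>R f z)"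
    unfolding pd_def frechet_derivative_at[OF D, symmetric] ..
  also have "\<dots> = (\<Sum>z\<in>nodes N. (diff_mat N \<xi> (x d) (z d) * of_bool (\<forall>j\<in>UNIV - {d}. z j = x j)) *\<^sub>R f z)"
  proof (rule sum.cong[OF refl])
    fix z assume z: "z \<in> nodes N"
    have "(\<Sum>e\<in>UNIV. axis d 1 $ e * L' z e * (\<Prod>j\<in>UNIV - {e}. L z j))
        = (\<Sum>e\<in>{d}. axis d 1 $ e * L' z e * (\<Prod>j\<in>UNIV - {e}. L z j))"
      by (intro sum.mono_neutral_right) (auto simp: axis_def)
    also have "\<dots> = diff_mat N \<xi> (x d) (z d) * of_bool (\<forall>j\<in>UNIV - {d}. z j = x j)"
      using prod_lagrange_node[OF x z, of "UNIV - {d}"]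
      by (simp add: L_def L'_def y_def diff_mat_def) (simp add: node_pt_def)
    finally show "(\<Sum>e\<in>UNIV. axis d 1 $ e * L' z e * (\<Prod>j\<in>UNIV - {e}. L z j)) *\<^sub>R f z
      = (diff_mat N \<xi> (x d) (z d) * of_bool (\<forall>j\<in>UNIV - {d}. z j = x j)) *\<^sub>R f z" by simp
  qed
  also have "\<dots> = (\<Sum>z\<in>(\<lambda>m. x(d := m)) ` {..N}. diff_mat N \<xi> (x d) (z d) *\<^sub>R f z)"
  proof (rule sum.mono_neutral_cong_right)
    show "\<forall>z\<in>nodes N - (\<lambda>m. x(d := m)) ` {..N}.
        (diff_mat N \<xi> (x d) (z d) * of_bool (\<forall>j\<in>UNIV - {d}. z j = x j)) *\<^sub>R f z = 0"
    proof (intro ballI)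
      fix z assume z: "z \<in> nodes N - (\<lambda>m. x(d := m)) ` {..N}"
      have "z = x(d := z d)" if "\<forall>j\<in>UNIV - {d}. z j = x j" using that by auto
      with z have "\<not> (\<forall>j\<in>UNIV - {d}. z j = x j)" by (metis DiffD1 DiffD2 atMost_iff image_eqI nodes_le)
      then show "(diff_mat N \<xi> (x d) (z d) * of_bool (\<forall>j\<in>UNIV - {d}. z j = x j)) *\<^sub>R f z = 0"
        by simp
    qed
  next
    show "(\<lambda>m. x(d := m)) ` {..N} \<subseteq> nodes N" using x by (intro image_subsetI nodes_update) simp_all
    fix z assume "z \<in> (\<lambda>m. x(d := m)) ` {..N}"
    then obtain m where z: "z = x(d := m)" by blast
    have "\<forall>j\<in>UNIV - {d}. z j = x j"
    proof
      fix j assume "j \<in> UNIV - {d}"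
      then show "z j = x j" unfolding z by (intro fun_upd_other) blast
    qed
    then have "of_bool (\<forall>j\<in>UNIV - {d}. z j = x j) = (1 :: real)"
      unfolding of_bool_def by (rule if_P)
    then show "(diff_mat N \<xi> (x d) (z d) * of_bool (\<forall>j\<in>UNIV - {d}. z j = x j)) *\<^sub>R f z
        = diff_mat N \<xi> (x d) (z d) *\<^sub>R f z"
      by (simp only: mult_1_right)
  qed (rule finite_nodes)
  also have "\<dots> = (\<Sum>m\<le>N. diff_mat N \<xi> (x d) m *\<^sub>R f (x(d := m)))"
  proof -
    have "inj_on (\<lambda>m. x(d := m)) {..N}" by (intro inj_onI) (erule fun_upd_eqD)
    then show ?thesis by (simp only: sum.reindex comp_def fun_upd_same)
  qed
  finally show ?thesis by (simp add: y_def)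
qed

end

text \<open>Interpolants of nodal values are therefore legitimate test functions.\<close>

lemma interp_tensor_polys: "interp N \<xi> f \<in> tensor_polys N"
proof -
  define c where "c = (\<lambda>j a. coeff (lagrange_poly N \<xi> j) a)"
  have lag: "lagrange N \<xi> j t = (\<Sum>a\<le>N. c j a * t ^ a)" if "j \<le> N" for j t
  proof -
    have "lagrange N \<xi> j t = poly (lagrange_poly N \<xi> j) t" by (simp add: poly_lagrange_poly)
    also have "\<dots> = (\<Sum>a\<le>N. c j a * t ^ a)"
      unfolding poly_altdef c_def using degree_lagrange_poly[OF that, of \<xi>]
      by (intro sum.mono_neutral_left) (auto simp: coeff_eq_0)
    finally show ?thesis .
  qed
  have "interp N \<xi> f y = (\<Sum>a\<in>nodes N. (\<Prod>d\<in>UNIV. (y $ d) ^ a d) *\<^sub>R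
      (\<Sum>x\<in>nodes N. (\<Prod>d\<in>UNIV. c (x d) (a d)) *\<^sub>R f x))" for y
  proof -
    have "interp N \<xi> f y = (\<Sum>x\<in>nodes N. (\<Prod>d\<in>UNIV. \<Sum>a\<le>N. c (x d) a * (y $ d) ^ a) *\<^sub>R f x)"
      unfolding interp_def by (intro sum.cong) (auto simp: lag)
    also have "\<dots> = (\<Sum>x\<in>nodes N. (\<Sum>a\<in>nodes N. \<Prod>d\<in>UNIV. c (x d) (a d) * (y $ d) ^ a d) *\<^sub>R f x)"
      unfolding nodes_eq_PiE by (subst prod_sum_PiE) auto
    also have "\<dots> = (\<Sum>a\<in>nodes N. (\<Prod>d\<in>UNIV. (y $ d) ^ a d) *\<^sub>R
      (\<Sum>x\<in>nodes N. (\<Prod>d\<in>UNIV. c (x d) (a d)) *\<^sub>R f x))"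
      unfolding scaleR_sum_left scaleR_sum_right
      by (subst sum.swap) (simp add: prod.distrib mult.commute)
    finally show ?thesis .
  qed
  then show ?thesis
    unfolding tensor_polys_def
    by (intro range_eqI[where x = "\<lambda>a. \<Sum>x\<in>nodes N. (\<Prod>d\<in>UNIV. c (x d) (a d)) *\<^sub>R f x"] ext)
qed

section \<open>Surface integrals\<close>

lemma surf_int_add:
  "surf_int N \<xi> M \<nu> (\<lambda>f x. g f x + h f x) = surf_int N \<xi> M \<nu> g + surf_int N \<xi> M \<nu> h"
  by (simp add: surf_int_def sum.distrib distrib_left distrib_right)

lemma surf_int_diff:
  "surf_int N \<xi> M \<nu> (\<lambda>f x. g f x - h f x) = surf_int N \<xi> M \<nu> g - surf_int N \<xi> M \<nu> h"
  by (simp add: surf_int_def sum_subtractf left_diff_distrib right_diff_distrib)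

lemma surf_int_cong:
  assumes "\<And>f x. x \<in> face_nodes N f \<Longrightarrow> g f x = h f x"
  shows "surf_int N \<xi> M \<nu> g = surf_int N \<xi> M \<nu> h"
  unfolding surf_int_def using assms by (intro sum.cong) auto

text \<open>This also holds where the metric vector vanishes: both sides are then zero.\<close>

lemma surf_elem_normal:
  "surf_elem M \<nu> f x *\<^sub>R normal M \<nu> f x = (if snd f then 1 else -1) *\<^sub>R (met M \<nu> x $ fst f)"
  by (cases "met M \<nu> x $ fst f = 0") (simp_all add: surf_elem_def normal_def sgn_div_norm)

lemma surf_int_normal:
  assumes "\<And>x. linear (h x)"
  shows "surf_int N \<xi> M \<nu> (\<lambda>f x. h x (normal M \<nu> f x)) = (\<Sum>d\<in>UNIV. boundary N \<xi> d (\<lambda>x. h x (met M \<nu> x $ d)))"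
proof -
  have h: "h x (normal M \<nu> f x) * surf_elem M \<nu> f x = (if snd f then 1 else -1) * h x (met M \<nu> x $ fst f)" for f x
  proof -
    have "h x (normal M \<nu> f x) * surf_elem M \<nu> f x = h x (surf_elem M \<nu> f x *\<^sub>R normal M \<nu> f x)"
      using linear_scale[OF assms] by (simp add: mult.commute)
    then show ?thesis unfolding surf_elem_normal using linear_scale[OF assms] by simp
  qed
  have "surf_int N \<xi> M \<nu> (\<lambda>f x. h x (normal M \<nu> f x))
     = (\<Sum>f\<in>UNIV. (if snd f then 1 else -1) * (\<Sum>x\<in>face_nodes N f. face_weight N \<xi> (fst f) x * h x (met M \<nu> x $ fst f)))"
    unfolding surf_int_def face_weight_def sum_distrib_left mult.assoc h by (simp add: ac_simps)
  also have "\<dots> = (\<Sum>d\<in>UNIV. \<Sum>b\<in>UNIV. (if b then 1 else -1) *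
      (\<Sum>x\<in>face_nodes N (d, b). face_weight N \<xi> d x * h x (met M \<nu> x $ d)))"
    unfolding sum.cartesian_product UNIV_Times_UNIV by (intro sum.cong) auto
  also have "\<dots> = (\<Sum>d\<in>UNIV. boundary N \<xi> d (\<lambda>x. h x (met M \<nu> x $ d)))"
    by (simp add: UNIV_bool boundary_def)
  finally show ?thesis .
qed

lemma contract_linear: "linear (\<lambda>c. w \<bullet> (G \<odot> c))" for w :: "'a :: real_inner"
  unfolding contract_def
  by (rule linearI) (simp_all add: inner_sum_right distrib_right sum.distrib sum_distrib_left mult.assoc)

lemma inner_contract: "w \<bullet> (G \<odot> c) = (\<Sum>l\<in>UNIV. c $ l * (w \<bullet> G $ l))" for w :: "'a :: real_inner"
  by (simp add: contract_def inner_sum_right)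

lemma contract_minus: "G \<odot> (- c) = - (G \<odot> c)"
  by (simp add: contract_def sum_negf)

lemma contract_avg: "avg F G \<odot> c = avg (F \<odot> c) (G \<odot> c)"
  by (simp add: contract_def avg_def scaleR_add_right sum.distrib scaleR_sum_right scaleR_left_commute)

context lgl
begin

text \<open>A symmetry of the square permutes the tangential directions, which permutes the factors, and reverses
  some of them, which preserves each factor by \<open>quad_weight_reflect\<close>.\<close>

lemma face_weight_symmetry:
  assumes h: "face_symmetry N f f' h" and x: "x \<in> face_nodes N f"
  shows "face_weight N \<xi> (fst f') (h x) = face_weight N \<xi> (fst f) x"
proof -
  obtain \<pi> R where \<pi>: "bij_betw \<pi> (UNIV - {fst f}) (UNIV - {fst f'})"
    and R: "\<And>e. e \<noteq> fst f \<Longrightarrow> h x (\<pi> e) = (if e \<in> R then N - x e else x e)"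
    using h x unfolding face_symmetry_def by metis
  have "face_weight N \<xi> (fst f') (h x) = (\<Prod>e\<in>UNIV - {fst f}. quad_weight N \<xi> (h x (\<pi> e)))"
    unfolding face_weight_def by (rule prod.reindex_bij_betw[OF \<pi>, symmetric])
  also have "\<dots> = face_weight N \<xi> (fst f) x"
    unfolding face_weight_def using face_nodes_in_nodes[OF x]
    by (intro prod.cong) (auto simp: R quad_weight_reflect)
  finally show ?thesis .
qed

text \<open>Gluing is an involution on the triples of element, face and face node, and it preserves quadrature
  weight and surface element. The sum of an integrand that it maps to its negative equals its own
  negative.\<close>

lemma interface_cancellation:
  assumes M: "conforming_periodic N M"
    and anti: "\<And>\<nu> f x \<nu>' f' x'. \<lbrakk>\<nu> \<in> elements M; x \<in> face_nodes N f; \<nu>' \<in> elements M; x' \<in> face_nodes N f';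
      nbr M (\<nu>, f) = (\<nu>', f'); nbr_node M (\<nu>, f) x = x'; nbr M (\<nu>', f') = (\<nu>, f);
      nbr_node M (\<nu>', f') x' = x; normal M \<nu>' f' x' = - normal M \<nu> f x\<rbrakk> \<Longrightarrow> g \<nu>' f' x' = - g \<nu> f x"
  shows "(\<Sum>\<nu>\<in>elements M. surf_int N \<xi> M \<nu> (g \<nu>)) = 0"
proof -
  define I where "I = (SIGMA \<nu>:elements M. SIGMA f:UNIV. face_nodes N f)"
  define \<tau> where "\<tau> = (\<lambda>(\<nu>, f, x). (fst (nbr M (\<nu>, f)), snd (nbr M (\<nu>, f)), nbr_node M (\<nu>, f) x))"
  define G where "G = (\<lambda>(\<nu>, f, x). face_weight N \<xi> (fst f) x * g \<nu> f x * surf_elem M \<nu> f x)"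
  have fin: "finite (elements M)" by (simp add: elements_def)
  have sum: "(\<Sum>\<nu>\<in>elements M. surf_int N \<xi> M \<nu> (g \<nu>)) = sum G I"
    unfolding surf_int_def I_def G_def face_weight_def using fin
    by (simp add: sum.Sigma)
  have \<tau>: "\<tau> i \<in> I \<and> \<tau> (\<tau> i) = i \<and> G (\<tau> i) = - G i" if "i \<in> I" for i
  proof -
    obtain \<nu> f x where i: "i = (\<nu>, f, x)" by (cases i)
    with that have \<nu>: "\<nu> \<in> elements M" and x: "x \<in> face_nodes N f" by (auto simp: I_def)
    obtain \<nu>' f' where n: "nbr M (\<nu>, f) = (\<nu>', f')" by (rule prod.exhaust)
    define x' where "x' = nbr_node M (\<nu>, f) x"
    from M \<nu> n have n': "\<nu>' \<in> elements M" "nbr M (\<nu>', f') = (\<nu>, f)"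
      and sym: "face_symmetry N f f' (nbr_node M (\<nu>, f))"
      and pt: "nbr_node M (\<nu>', f') x' = x" "surf_elem M \<nu>' f' x' = surf_elem M \<nu> f x"
        "normal M \<nu>' f' x' = - normal M \<nu> f x"
      using x unfolding conforming_periodic_def Let_def x'_def by blast+
    have x': "x' \<in> face_nodes N f'" using sym x unfolding face_symmetry_def x'_def by blast
    have "g \<nu>' f' x' = - g \<nu> f x"
      by (rule anti[OF \<nu> x n'(1) x' n x'_def[symmetric] n'(2) pt(1,3)])
    moreover have "face_weight N \<xi> (fst f') x' = face_weight N \<xi> (fst f) x"
      unfolding x'_def by (rule face_weight_symmetry[OF sym x])
    moreover have "\<tau> i = (\<nu>', f', x')" by (simp add: \<tau>_def i n x'_def)
    ultimately show ?thesis
      using n' x' pt by (simp add: G_def I_def i \<tau>_def)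
  qed
  have "sum G I = (\<Sum>i\<in>I. - G i)"
    by (rule sum.reindex_bij_witness[of _ \<tau> \<tau>]) (use \<tau> in auto)
  then show ?thesis unfolding sum by (simp add: sum_negf)
qed

end

section \<open>Entropy balance of the volume terms\<close>

lemma ec_flux_jump_contract:
  assumes "adiab P > 1" "dens a > 0" "pressure P a > 0" "dens b > 0" "pressure P b > 0"
  shows "(entropy_vars P b - entropy_vars P a) \<bullet> (ec_flux P a b \<odot> c)
    = (entropy_potential P b - entropy_potential P a) \<bullet> c
      - (avg (mag a) (mag b) \<bullet> c) * (godunov_scalar P b - godunov_scalar P a)"
proof -
  have "(entropy_vars P b - entropy_vars P a) \<bullet> (ec_flux P a b \<odot> c)
    = (\<Sum>l\<in>UNIV. c $ l * (entropy_potential P b $ l - entropy_potential P a $ l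
      - avg (mag a) (mag b) $ l * (godunov_scalar P b - godunov_scalar P a)))"
    unfolding inner_contract ec_flux_jump[OF assms] ..
  then show ?thesis
    by (simp add: inner_vec_def sum_distrib_left sum_subtractf sum.distrib algebra_simps)
qed

lemma entropy_vars_Phi_GLM_contract: "entropy_vars P u \<bullet> (Phi_GLM u \<odot> c) = 0"
  by (simp add: inner_contract entropy_vars_Phi_GLM)

lemma inner_N_div_split:
  "inner_N N \<xi> (div_split N \<xi> F A U) W
    = (\<Sum>d\<in>UNIV. 2 * line_form N \<xi> d (\<lambda>x y. W x \<bullet> (F (U x) (U y) \<odot> avg (A x $ d) (A y $ d))))"
  unfolding inner_N_def div_split_def line_form_def inner_sum_left inner_scaleR_left sum_distrib_left
  by (subst sum.swap) (simp add: ac_simps inner_commute)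

lemma inner_N_div_NC:
  "inner_N N \<xi> (div_NC N \<xi> A U) (\<lambda>x. entropy_vars P (U x))
    = (\<Sum>d\<in>UNIV. line_form N \<xi> d
        (\<lambda>x y. godunov_scalar P (U x) * (mag (U y) \<bullet> avg (A x $ d) (A y $ d))))"
proof -
  have "inner_N N \<xi> (div_NC N \<xi> A U) (\<lambda>x. entropy_vars P (U x))
      = (\<Sum>x\<in>nodes N. \<Sum>m\<le>N. \<Sum>d\<in>UNIV. weight3 N \<xi> x * (diff_mat N \<xi> (x d) m *
          (godunov_scalar P (U x) * (mag (U (x(d := m))) \<bullet> avg (A x $ d) (A (x(d := m)) $ d)))))"
    unfolding inner_N_def div_NC_def inner_scaleR_left
    by (simp add: inner_commute[of "Phi_MHD _"] entropy_vars_Phi_MHD sum_distrib_left sum_distrib_right ac_simps)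
  also have "\<dots> = (\<Sum>x\<in>nodes N. \<Sum>d\<in>UNIV. \<Sum>m\<le>N. weight3 N \<xi> x * (diff_mat N \<xi> (x d) m *
          (godunov_scalar P (U x) * (mag (U (x(d := m))) \<bullet> avg (A x $ d) (A (x(d := m)) $ d)))))"
    by (intro sum.cong[OF refl] sum.swap)
  finally show ?thesis
    unfolding line_form_def sum_distrib_left by (subst (asm) sum.swap)
qed

lemma inner_N_grad_NC:
  "inner_N N \<xi> (grad_NC N \<xi> A U) (\<lambda>x. entropy_vars P (U x)) = 0"
  by (simp add: inner_N_def grad_NC_def inner_sum_left inner_commute[of "Phi_GLM _ \<odot> _"]
      entropy_vars_Phi_GLM_contract)

context lgl
begin

text \<open>The tested flux divergence contributes \<open>[[\<theta>]] {{B}} - [[\<Psi>]]\<close> and the non-conservative term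
  contributes \<open>\<theta>\<^sub>x B\<^sub>y\<close> between the nodes \<open>x\<close> and \<open>y\<close>. Together they are the jump of \<open>\<theta> B / 2 - \<Psi>\<close> plus the
  symmetric form \<open>(\<theta>\<^sub>x B\<^sub>y + \<theta>\<^sub>y B\<^sub>x) / 2\<close>. Jumps and symmetric forms reduce to boundary terms,
  the former thanks to the metric identities.\<close>

lemma volume_entropy_balance:
  assumes g: "adiab P > 1"
    and adm: "\<And>x. x \<in> nodes N \<Longrightarrow> dens (U x) > 0 \<and> pressure P (U x) > 0"
    and metric: "\<And>x. x \<in> nodes N \<Longrightarrow> (\<Sum>d\<in>UNIV. \<Sum>m\<le>N. diff_mat N \<xi> (x d) m *\<^sub>R A (x(d := m)) $ d) = 0"
  defines "W \<equiv> \<lambda>x. entropy_vars P (U x)"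
  shows "inner_N N \<xi> (div_split N \<xi> (ec_flux P) A U) W + inner_N N \<xi> (div_NC N \<xi> A U) W
    = (\<Sum>d\<in>UNIV. boundary N \<xi> d (\<lambda>x. W x \<bullet> (adv_flux P (U x) \<odot> A x $ d)
        + godunov_scalar P (U x) * (mag (U x) \<bullet> A x $ d) - entropy_potential P (U x) \<bullet> A x $ d))"
proof -
  define \<theta> where "\<theta> = (\<lambda>x. godunov_scalar P (U x))"
  define \<Psi> where "\<Psi> = (\<lambda>x. entropy_potential P (U x))"
  define B where "B = (\<lambda>x. mag (U x))"
  define X where "X = (\<lambda>x. (1/2 * \<theta> x) *\<^sub>R B x - \<Psi> x)"
  have line: "2 * line_form N \<xi> d (\<lambda>x y. W x \<bullet> (ec_flux P (U x) (U y) \<odot> avg (A x $ d) (A y $ d)))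
      + line_form N \<xi> d (\<lambda>x y. \<theta> x * (B y \<bullet> avg (A x $ d) (A y $ d)))
      = boundary N \<xi> d (\<lambda>x. W x \<bullet> (adv_flux P (U x) \<odot> A x $ d) + \<theta> x * (B x \<bullet> A x $ d) - \<Psi> x \<bullet> A x $ d)
        - line_form N \<xi> d (\<lambda>x y. X x \<bullet> A y $ d)" for d
  proof -
    define a where "a = (\<lambda>x. A x $ d)"
    have a: "A x $ d = a x" for x by (simp add: a_def)
    define K where "K = (\<lambda>x y. W x \<bullet> (ec_flux P (U x) (U y) \<odot> avg (a x) (a y)))"
    define S where "S = (\<lambda>x y. 1/2 * ((\<theta> x *\<^sub>R B y + \<theta> y *\<^sub>R B x) \<bullet> avg (a x) (a y)))"
    have K: "2 * line_form N \<xi> d K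
        = boundary N \<xi> d (\<lambda>x. W x \<bullet> (adv_flux P (U x) \<odot> a x)) + line_form N \<xi> d (\<lambda>x y. K x y - K y x)"
    proof -
      have "boundary N \<xi> d (\<lambda>x. K x x) = boundary N \<xi> d (\<lambda>x. W x \<bullet> (adv_flux P (U x) \<odot> a x))"
        by (rule boundary_cong) (simp add: K_def ec_flux_consistent g adm)
      then show ?thesis
        using line_form_transpose[of d K] by (simp add: line_form_diff)
    qed
    have "line_form N \<xi> d (\<lambda>x y. K x y - K y x) + line_form N \<xi> d (\<lambda>x y. \<theta> x * (B y \<bullet> avg (a x) (a y)))
        = line_form N \<xi> d (\<lambda>x y. (X y - X x) \<bullet> avg (a x) (a y) + S x y)"
      unfolding line_form_add[symmetric]
    proof (rule line_form_cong)
      fix x m assume x: "x \<in> nodes N" "m \<le> N"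
      define y where "y = x(d := m)"
      define c where "c = avg (a x) (a y)"
      have y: "y \<in> nodes N" using x by (simp add: y_def)
      have "K x y - K y x = - ((W y - W x) \<bullet> (ec_flux P (U x) (U y) \<odot> c))"
        by (simp add: K_def c_def inner_diff_left ec_flux_commute[of P "U y"] avg_commute[of "a y"])
      also have "\<dots> = (avg (B x) (B y) \<bullet> c) * (\<theta> y - \<theta> x) - (\<Psi> y - \<Psi> x) \<bullet> c"
        using ec_flux_jump_contract[OF g, of "U x" "U y" c] adm[OF x(1)] adm[OF y]
        by (simp add: W_def B_def \<theta>_def \<Psi>_def)
      finally have "K x y - K y x + \<theta> x * (B y \<bullet> c) = (X y - X x) \<bullet> c
          + 1/2 * ((\<theta> x *\<^sub>R B y + \<theta> y *\<^sub>R B x) \<bullet> c)"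
        by (simp add: X_def avg_def inner_diff_left inner_add_left field_simps)
      then show "K x (x(d := m)) - K (x(d := m)) x + \<theta> x * (B (x(d := m)) \<bullet> avg (a x) (a (x(d := m))))
          = (X (x(d := m)) - X x) \<bullet> avg (a x) (a (x(d := m))) + S x (x(d := m))"
        by (simp only: S_def c_def y_def)
    qed
    moreover have "line_form N \<xi> d S = 1/2 * boundary N \<xi> d (\<lambda>x. \<theta> x * (B x \<bullet> a x))"
    proof -
      have "S x y = S y x" for x y by (simp add: S_def avg_commute add.commute)
      from line_form_symmetric[of S d, OF this] show ?thesis
        by (simp add: S_def flip: scaleR_2)
    qed
    moreover have "boundary N \<xi> d (\<lambda>x. X x \<bullet> a x)
        = 1/2 * boundary N \<xi> d (\<lambda>x. \<theta> x * (B x \<bullet> a x)) - boundary N \<xi> d (\<lambda>x. \<Psi> x \<bullet> a x)"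
      by (simp add: X_def inner_diff_left boundary_diff flip: boundary_cmult)
    ultimately show ?thesis
      unfolding a K_def[symmetric]
      using K by (simp add: line_form_add line_form_skew_product boundary_add boundary_diff)
  qed
  have "(\<Sum>d\<in>UNIV. line_form N \<xi> d (\<lambda>x y. X x \<bullet> A y $ d))
      = (\<Sum>x\<in>nodes N. weight3 N \<xi> x * (X x \<bullet> (\<Sum>d\<in>UNIV. \<Sum>m\<le>N. diff_mat N \<xi> (x d) m *\<^sub>R A (x(d := m)) $ d)))"
    unfolding line_form_def inner_sum_right inner_scaleR_right sum_distrib_left by (rule sum.swap)
  also have "\<dots> = 0" by (simp add: metric)
  finally have "(\<Sum>d\<in>UNIV. line_form N \<xi> d (\<lambda>x y. X x \<bullet> A y $ d)) = 0" .
  then show ?thesis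
    unfolding inner_N_div_split inner_N_div_NC[of N \<xi> A U P, folded W_def] sum.distrib[symmetric]
    using line by (simp add: \<theta>_def B_def \<Psi>_def sum_subtractf)
qed

end

section \<open>Entropy balance of an element\<close>

lemma inner_N_cong:
  assumes "\<And>x. x \<in> nodes N \<Longrightarrow> f x = f' x" "\<And>x. x \<in> nodes N \<Longrightarrow> g x = g' x"
  shows "inner_N N \<xi> f g = inner_N N \<xi> f' g'"
  unfolding inner_N_def using assms by (intro sum.cong) auto

lemma linear_boundary_density:
  fixes w :: state and b p :: "real^3"
  shows "linear (\<lambda>c. w \<bullet> (G \<odot> c) + t * (b \<bullet> c) - p \<bullet> c)"
proof -
  have "linear (\<lambda>c. t * (b \<bullet> c))" "linear (\<lambda>c. p \<bullet> c)"
    by (auto intro!: linearI simp: inner_add_right algebra_simps)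
  then show ?thesis by (intro linear_compose_add linear_compose_sub contract_linear)
qed

text \<open>The entropy that crosses a face by advection: the tested numerical flux and non-conservative
  interface term, minus the potential left over by the volume terms.\<close>

definition advective_density :: "phys \<Rightarrow> state \<Rightarrow> state \<Rightarrow> real^3 \<Rightarrow> real" where
  "advective_density P u u' n = entropy_vars P u \<bullet> (ec_flux P u u' \<odot> n)
     + godunov_scalar P u * (avg (mag u) (mag u') \<bullet> n) - entropy_potential P u \<bullet> n"

text \<open>The face terms of both equations combined: the interface value of the entropy variables from the
  gradient equation, and the difference of numerical and inner viscous flux from the main equation.\<close>

definition viscous_density :: "state \<Rightarrow> state \<Rightarrow> state^3 \<Rightarrow> state^3 \<Rightarrow> real^3 \<Rightarrow> real" where
  "viscous_density w w' F F' n =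
     avg w w' \<bullet> (F \<odot> n) + w \<bullet> (avg F F' \<odot> n) - w \<bullet> (F \<odot> n)"

text \<open>Adding the contributions of both sides leaves exactly the defect in the jump identity of the entropy
  conservative flux, which is zero.\<close>

lemma advective_density_antisymmetric:
  assumes "adiab P > 1" "dens a > 0" "pressure P a > 0" "dens b > 0" "pressure P b > 0"
  shows "advective_density P b a (- n) = - advective_density P a b n"
proof -
  have "(entropy_vars P b - entropy_vars P a) \<bullet> (ec_flux P a b \<odot> n)
    = (entropy_potential P b - entropy_potential P a) \<bullet> n
      - (avg (mag a) (mag b) \<bullet> n) * (godunov_scalar P b - godunov_scalar P a)"
    by (rule ec_flux_jump_contract[OF assms])
  then show ?thesis
    unfolding advective_density_def ec_flux_commute[of P b a] avg_commute[of "mag b"] contract_minus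
    by (simp add: inner_diff_left algebra_simps)
qed

text \<open>The product rule \<open>[[w \<cdot> F]] = {{w}} \<cdot> [[F]] + [[w]] \<cdot> {{F}}\<close>; averaging both quantities makes the two sides
  balance.\<close>

lemma viscous_density_antisymmetric:
  "viscous_density w' w F' F (- n) = - viscous_density w w' F F' n"
  unfolding viscous_density_def contract_minus contract_avg avg_commute[of w'] avg_commute[of "F' \<odot> n"]
  by (simp add: avg_def inner_add_left inner_add_right algebra_simps)

context lgl
begin

text \<open>Test the gradient equation with the viscous flux. Its volume term is then the tested divergence of
  that flux, because differentiating an interpolant at a node is applying the derivative matrix.\<close>

lemma viscous_volume_term:
  assumes grad: "gradient_equation P N \<xi> M H U Q \<nu> (interp N \<xi> F)" and H: "W_num H = avg"
  defines "W \<equiv> \<lambda>\<nu> x. entropy_vars P (U \<nu> x)"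
  shows "inner_N N \<xi> (div_std N \<xi> (met M \<nu>) F) (W \<nu>)
    = surf_int N \<xi> M \<nu> (\<lambda>f x. avg (W \<nu> x) (ext_val M W \<nu> f x) \<bullet> (F x \<odot> normal M \<nu> f x))
      - inner_N N \<xi> (\<lambda>x. jac M \<nu> x *\<^sub>R Q \<nu> x) F"
proof -
  have node: "interp N \<xi> F (node_pt \<xi> x) = F x" if "x \<in> nodes N" for x
    using that by (rule interp_node)
  have "inner_N N \<xi> (W \<nu>) (\<lambda>x. \<Sum>i\<in>UNIV. pd i
          (interp N \<xi> (\<lambda>z. interp N \<xi> F (node_pt \<xi> z) \<odot> (met M \<nu> z $ i))) (node_pt \<xi> x))
      = inner_N N \<xi> (W \<nu>) (div_std N \<xi> (met M \<nu>) F)"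
  proof (rule inner_N_cong)
    fix x assume x: "x \<in> nodes N"
    have "(\<Sum>i\<in>UNIV. pd i
          (interp N \<xi> (\<lambda>z. interp N \<xi> F (node_pt \<xi> z) \<odot> (met M \<nu> z $ i))) (node_pt \<xi> x))
        = (\<Sum>i\<in>UNIV. \<Sum>m\<le>N. diff_mat N \<xi> (x i) m *\<^sub>R (F (x(i := m)) \<odot> (met M \<nu> (x(i := m)) $ i)))"
      unfolding pd_interp_node[OF x] using x by (intro sum.cong refl) (simp add: node)
    also have "\<dots> = div_std N \<xi> (met M \<nu>) F x"
      unfolding div_std_def by (rule sum.swap)
    finally show "(\<Sum>i\<in>UNIV. pd i
          (interp N \<xi> (\<lambda>z. interp N \<xi> F (node_pt \<xi> z) \<odot> (met M \<nu> z $ i))) (node_pt \<xi> x))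
        = div_std N \<xi> (met M \<nu>) F x" .
  qed simp
  moreover have "inner_N N \<xi> (\<lambda>x. jac M \<nu> x *\<^sub>R Q \<nu> x) (\<lambda>x. interp N \<xi> F (node_pt \<xi> x))
      = inner_N N \<xi> (\<lambda>x. jac M \<nu> x *\<^sub>R Q \<nu> x) F"
    by (rule inner_N_cong) (simp_all add: node)
  moreover have "surf_int N \<xi> M \<nu> (\<lambda>f x. avg (W \<nu> x) (ext_val M W \<nu> f x)
        \<bullet> (interp N \<xi> F (node_pt \<xi> x) \<odot> normal M \<nu> f x))
      = surf_int N \<xi> M \<nu> (\<lambda>f x. avg (W \<nu> x) (ext_val M W \<nu> f x) \<bullet> (F x \<odot> normal M \<nu> f x))"
    by (rule surf_int_cong) (simp add: node face_nodes_in_nodes)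
  moreover have "inner_N N \<xi> (div_std N \<xi> (met M \<nu>) F) (W \<nu>) = inner_N N \<xi> (W \<nu>) (div_std N \<xi> (met M \<nu>) F)"
    by (simp add: inner_N_def inner_commute)
  ultimately show ?thesis
    using grad unfolding gradient_equation_def Let_def H W_def by simp
qed

lemma element_entropy_balance:
  assumes g: "adiab P > 1"
    and adm: "\<And>x. x \<in> nodes N \<Longrightarrow> dens (U \<nu> x) > 0 \<and> pressure P (U \<nu> x) > 0"
    and metric: "metric_identities N \<xi> M" and \<nu>: "\<nu> \<in> elements M"
    and H: "Fa_vol H = ec_flux P" "Fa_num H = (\<lambda>um up n. ec_flux P um up \<odot> n)"
      "mhd_num H = (\<lambda>um up n. (avg (mag um) (mag up) \<bullet> n) *\<^sub>R Phi_MHD um)"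
      "glm_num H = (\<lambda>um up n. avg (glm um) (glm up) *\<^sub>R (Phi_GLM um \<odot> n))"
      "Fv_num H = (\<lambda>Fm Fp n. avg Fm Fp \<odot> n)" "W_num H = avg"
    and main: "\<And>\<phi>. \<phi> \<in> tensor_polys N \<Longrightarrow> main_equation P N \<xi> M H U Ut Q \<nu> \<phi>"
    and grad: "\<And>\<theta>. \<theta> \<in> tensor_polys N \<Longrightarrow> gradient_equation P N \<xi> M H U Q \<nu> \<theta>"
  defines "W \<equiv> \<lambda>\<nu> x. entropy_vars P (U \<nu> x)" and "Fv \<equiv> \<lambda>\<nu> x. visc_nodal P (U \<nu> x) (Q \<nu> x)"
  shows "inner_N N \<xi> (\<lambda>x. jac M \<nu> x *\<^sub>R Ut \<nu> x) (W \<nu>)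
    = surf_int N \<xi> M \<nu> (\<lambda>f x.
        viscous_density (W \<nu> x) (ext_val M W \<nu> f x) (Fv \<nu> x) (ext_val M Fv \<nu> f x) (normal M \<nu> f x)
        - advective_density P (U \<nu> x) (ext_val M U \<nu> f x) (normal M \<nu> f x))
      - inner_N N \<xi> (\<lambda>x. jac M \<nu> x *\<^sub>R Q \<nu> x) (Fv \<nu>)
      + inner_N N \<xi> (\<lambda>x. jac M \<nu> x *\<^sub>R damp_source P (U \<nu> x)) (W \<nu>)"
proof -
  define A where "A = met M \<nu>"
  define n where "n = normal M \<nu>"
  define u where "u = U \<nu>"
  define ue where "ue = ext_val M U \<nu>"
  define w where "w = W \<nu>"
  define \<phi> where "\<phi> = (\<lambda>x. interp N \<xi> w (node_pt \<xi> x))"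
  have node: "\<phi> x = w x" if "x \<in> nodes N" for x
    using that by (simp add: \<phi>_def interp_node)
  have vol: "inner_N N \<xi> g \<phi> = inner_N N \<xi> g w" for g
    by (rule inner_N_cong) (simp_all add: node)
  have surf: "surf_int N \<xi> M \<nu> (\<lambda>f x. \<phi> x \<bullet> g f x) = surf_int N \<xi> M \<nu> (\<lambda>f x. w x \<bullet> g f x)" for g
    by (rule surf_int_cong) (simp add: node face_nodes_in_nodes)
  have discrete_metric: "(\<Sum>d\<in>UNIV. \<Sum>m\<le>N. diff_mat N \<xi> (x d) m *\<^sub>R A (x(d := m)) $ d) = 0"
    if x: "x \<in> nodes N" for x
  proof -
    have "\<forall>d. \<bar>node_pt \<xi> x $ d\<bar> \<le> 1" using x by (simp add: node_pt_def node_bound)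
    then have "(\<Sum>d\<in>UNIV. pd d (interp N \<xi> (\<lambda>x. A x $ d $ k)) (node_pt \<xi> x)) = 0" for k
      using metric \<nu> unfolding metric_identities_def A_def by blast
    then show ?thesis
      by (simp add: pd_interp_node[OF x] vec_eq_iff)
  qed
  have adv: "inner_N N \<xi> (div_split N \<xi> (ec_flux P) A u) w + inner_N N \<xi> (div_NC N \<xi> A u) w
      = surf_int N \<xi> M \<nu> (\<lambda>f x. w x \<bullet> (adv_flux P (u x) \<odot> n f x)
        + godunov_scalar P (u x) * (mag (u x) \<bullet> n f x) - entropy_potential P (u x) \<bullet> n f x)"
    unfolding n_def surf_int_normal[OF linear_boundary_density] w_def W_def u_def A_def[symmetric]
    by (rule volume_entropy_balance[OF g adm discrete_metric])
  have visc: "inner_N N \<xi> (div_std N \<xi> A (Fv \<nu>)) w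
    = surf_int N \<xi> M \<nu> (\<lambda>f x. avg (w x) (ext_val M W \<nu> f x) \<bullet> (Fv \<nu> x \<odot> n f x))
      - inner_N N \<xi> (\<lambda>x. jac M \<nu> x *\<^sub>R Q \<nu> x) (Fv \<nu>)"
    unfolding A_def w_def W_def n_def
    by (rule viscous_volume_term[OF grad[OF interp_tensor_polys] H(6)])
  have glm: "inner_N N \<xi> (grad_NC N \<xi> A u) w = 0"
    "w x \<bullet> (avg (glm (u x)) (glm (ue f x)) *\<^sub>R (Phi_GLM (u x) \<odot> n f x)
       - glm (u x) *\<^sub>R (Phi_GLM (u x) \<odot> n f x)) = 0" for f x
    unfolding w_def W_def u_def
    by (simp_all add: inner_N_grad_NC inner_diff_right entropy_vars_Phi_GLM_contract)
  have mhd: "w x \<bullet> ((avg (mag (u x)) (mag (ue f x)) \<bullet> n f x) *\<^sub>R Phi_MHD (u x) - (mag (u x) \<bullet> n f x) *\<^sub>R Phi_MHD (u x))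
     = godunov_scalar P (u x) * (avg (mag (u x)) (mag (ue f x)) \<bullet> n f x)
       - godunov_scalar P (u x) * (mag (u x) \<bullet> n f x)" for f x
    unfolding w_def W_def u_def by (simp add: inner_diff_right entropy_vars_Phi_MHD)
  have ew: "entropy_vars P (u x) = w x" for x by (simp add: w_def W_def u_def)
  have zero: "surf_int N \<xi> M \<nu> (\<lambda>f x. 0) = 0" by (simp add: surf_int_def)
  have "main_equation P N \<xi> M H U Ut Q \<nu> (interp N \<xi> w)"
    by (rule main[OF interp_tensor_polys])
  then have eq: "inner_N N \<xi> (\<lambda>x. jac M \<nu> x *\<^sub>R Ut \<nu> x) w
     + inner_N N \<xi> (div_split N \<xi> (ec_flux P) A u) w
     + surf_int N \<xi> M \<nu> (\<lambda>f x. w x \<bullet> (ec_flux P (u x) (ue f x) \<odot> n f x - adv_flux P (u x) \<odot> n f x))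
     + inner_N N \<xi> (div_NC N \<xi> A u) w
     + surf_int N \<xi> M \<nu> (\<lambda>f x. godunov_scalar P (u x) * (avg (mag (u x)) (mag (ue f x)) \<bullet> n f x)
       - godunov_scalar P (u x) * (mag (u x) \<bullet> n f x))
     = inner_N N \<xi> (div_std N \<xi> A (Fv \<nu>)) w
     + surf_int N \<xi> M \<nu> (\<lambda>f x. w x \<bullet> (avg (Fv \<nu> x) (ext_val M Fv \<nu> f x) \<odot> n f x - Fv \<nu> x \<odot> n f x))
     + inner_N N \<xi> (\<lambda>x. jac M \<nu> x *\<^sub>R damp_source P (u x)) w"
    unfolding main_equation_def Let_def H \<phi>_def[symmetric] vol surf
      A_def[symmetric] u_def[symmetric] ue_def[symmetric] n_def[symmetric] glm mhd zero Fv_def[symmetric]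
    by simp
  show ?thesis
    using eq adv visc
    unfolding w_def[symmetric] u_def[symmetric] ue_def[symmetric] n_def[symmetric]
      viscous_density_def advective_density_def ew
    by (simp add: surf_int_add surf_int_diff inner_diff_right flip: W_def)
qed

end


section \<open>Entropy stability\<close>

lemma entropy_time_derivative:
  assumes g: "adiab P > 1" and adm: "dens (U t) > 0" "pressure P (U t) > 0"
    and U: "(U has_vector_derivative U') (at t within T)"
  shows "((\<lambda>s. entropy P (U s)) has_real_derivative entropy_vars P (U t) \<bullet> U') (at t within T)"
  using vector_derivative_diff_chain_within[OF U
      has_derivative_at_withinI[OF entropy_vars_gradient[OF g adm]]]
  by (simp add: comp_def has_real_derivative_iff_has_vector_derivative)

lemma damp_source_dissipative:
  assumes "phys_ok P" "dens u > 0" "pressure P u > 0"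
  shows "damp_source P u \<bullet> entropy_vars P u \<le> 0"
proof -
  have "damp_source P u \<bullet> entropy_vars P u = - (damp P * (2 * beta P u) * (glm u)\<^sup>2)"
    by (simp add: damp_source_def entropy_vars_def power2_eq_square)
  also have "\<dots> \<le> 0" using assms beta_pos[of u P] by (simp add: phys_ok_def)
  finally show ?thesis .
qed

theorem theorem2:
  fixes P :: phys and N :: nat and \<xi> :: "nat \<Rightarrow> real" and M :: mesh and H :: num_choice
    and T :: "real set"
    and U :: "real \<Rightarrow> nat \<Rightarrow> node \<Rightarrow> state" and Q :: "real \<Rightarrow> nat \<Rightarrow> node \<Rightarrow> state^3"
  assumes "phys_ok P"
    and "N \<ge> 1" and "lgl_nodes N \<xi>"
    and "conforming_periodic N M" and "positive_jacobians N M" and "metric_identities N \<xi> M"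
    and "Fa_vol H = ec_flux P"
    and "Fa_num H = (\<lambda>um up n. ec_flux P um up \<odot> n)"
    and "mhd_num H = (\<lambda>um up n. (avg (mag um) (mag up) \<bullet> n) *\<^sub>R Phi_MHD um)"
    and "glm_num H = (\<lambda>um up n. avg (glm um) (glm up) *\<^sub>R (Phi_GLM um \<odot> n))"
    and "Fv_num H = (\<lambda>Fm Fp n. avg Fm Fp \<odot> n)"
    and "W_num H = avg"
    and "is_interval T" and "interior T \<noteq> {}"
    and "dgsem_solution P N \<xi> M H T U Q"
    and "\<forall>t\<in>T. \<forall>\<nu>\<in>elements M. \<forall>x\<in>nodes N. dens (U t \<nu> x) > 0 \<and> pressure P (U t \<nu> x) > 0"
  shows "\<forall>t\<in>T. \<exists>D\<le>0. ((\<lambda>s. total_entropy P N \<xi> M (U s)) has_real_derivative D) (at t within T)"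
proof
  fix t assume t: "t \<in> T"
  interpret lgl N \<xi> using assms(2,3) by unfold_locales
  have g: "adiab P > 1" using assms(1) by (simp add: phys_ok_def)
  have adm: "dens (U t \<nu> x) > 0" "pressure P (U t \<nu> x) > 0" if "\<nu> \<in> elements M" "x \<in> nodes N" for \<nu> x
    using assms(16) t that by blast+
  have J: "jac M \<nu> x > 0" if "\<nu> \<in> elements M" "x \<in> nodes N" for \<nu> x
    using assms(5) that by (simp add: positive_jacobians_def)
  obtain Ut where Ut: "\<And>\<nu> x. \<nu> \<in> elements M \<Longrightarrow> x \<in> nodes N \<Longrightarrow>
        ((\<lambda>s. U s \<nu> x) has_vector_derivative Ut t \<nu> x) (at t within T)"
    and main: "\<And>\<nu> \<phi>. \<nu> \<in> elements M \<Longrightarrow> \<phi> \<in> tensor_polys N \<Longrightarrow>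
        main_equation P N \<xi> M H (U t) (Ut t) (Q t) \<nu> \<phi>"
    and grad: "\<And>\<nu> \<theta>. \<nu> \<in> elements M \<Longrightarrow> \<theta> \<in> tensor_polys N \<Longrightarrow>
        gradient_equation P N \<xi> M H (U t) (Q t) \<nu> \<theta>"
    using assms(15) t unfolding dgsem_solution_def by blast
  define W where "W = (\<lambda>\<nu> x. entropy_vars P (U t \<nu> x))"
  define Fv where "Fv = (\<lambda>\<nu> x. visc_nodal P (U t \<nu> x) (Q t \<nu> x))"
  define flux where "flux = (\<lambda>\<nu> f x.
    viscous_density (W \<nu> x) (ext_val M W \<nu> f x) (Fv \<nu> x) (ext_val M Fv \<nu> f x) (normal M \<nu> f x)
    - advective_density P (U t \<nu> x) (ext_val M (U t) \<nu> f x) (normal M \<nu> f x))"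
  define D where "D = (\<Sum>\<nu>\<in>elements M. inner_N N \<xi> (\<lambda>x. jac M \<nu> x *\<^sub>R Ut t \<nu> x) (W \<nu>))"
  have "((\<lambda>s. total_entropy P N \<xi> M (U s)) has_real_derivative
      (\<Sum>\<nu>\<in>elements M. \<Sum>x\<in>nodes N. weight3 N \<xi> x * jac M \<nu> x * (W \<nu> x \<bullet> Ut t \<nu> x))) (at t within T)"
    unfolding total_entropy_def W_def
    by (intro DERIV_sum DERIV_cmult entropy_time_derivative[OF g] adm Ut)
  also have "(\<Sum>\<nu>\<in>elements M. \<Sum>x\<in>nodes N. weight3 N \<xi> x * jac M \<nu> x * (W \<nu> x \<bullet> Ut t \<nu> x)) = D"
    by (simp add: D_def inner_N_def inner_commute mult.assoc)
  finally have deriv: "((\<lambda>s. total_entropy P N \<xi> M (U s)) has_real_derivative D) (at t within T)" .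
  have balance: "inner_N N \<xi> (\<lambda>x. jac M \<nu> x *\<^sub>R Ut t \<nu> x) (W \<nu>)
      \<le> surf_int N \<xi> M \<nu> (flux \<nu>)" if \<nu>: "\<nu> \<in> elements M" for \<nu>
  proof -
    have "inner_N N \<xi> (\<lambda>x. jac M \<nu> x *\<^sub>R Ut t \<nu> x) (W \<nu>) = surf_int N \<xi> M \<nu> (flux \<nu>)
        - inner_N N \<xi> (\<lambda>x. jac M \<nu> x *\<^sub>R Q t \<nu> x) (Fv \<nu>)
        + inner_N N \<xi> (\<lambda>x. jac M \<nu> x *\<^sub>R damp_source P (U t \<nu> x)) (W \<nu>)"
      unfolding flux_def W_def Fv_def
      by (rule element_entropy_balance[OF g _ assms(6) \<nu> assms(7-12)])
         (use adm \<nu> main grad in auto)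
    moreover have "inner_N N \<xi> (\<lambda>x. jac M \<nu> x *\<^sub>R Q t \<nu> x) (Fv \<nu>) \<ge> 0"
      unfolding inner_N_def Fv_def inner_scaleR_left
      by (intro sum_nonneg mult_nonneg_nonneg visc_nodal_dissipative[OF assms(1)] adm[OF \<nu>]
          less_imp_le[OF J[OF \<nu>]] less_imp_le[OF weight3_pos])
    moreover have "inner_N N \<xi> (\<lambda>x. jac M \<nu> x *\<^sub>R damp_source P (U t \<nu> x)) (W \<nu>) \<le> 0"
      unfolding inner_N_def W_def inner_scaleR_left
      by (intro sum_nonpos mult_nonneg_nonpos damp_source_dissipative[OF assms(1)] adm[OF \<nu>]
          less_imp_le[OF J[OF \<nu>]] less_imp_le[OF weight3_pos])
    ultimately show ?thesis by simp
  qed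
  have "D \<le> (\<Sum>\<nu>\<in>elements M. surf_int N \<xi> M \<nu> (flux \<nu>))"
    unfolding D_def by (intro sum_mono balance)
  also have "\<dots> = 0"
  proof (rule interface_cancellation[OF assms(4)])
    fix \<nu> f x \<nu>' f' x'
    assume glued: "\<nu> \<in> elements M" "x \<in> face_nodes N f" "\<nu>' \<in> elements M" "x' \<in> face_nodes N f'"
      "nbr M (\<nu>, f) = (\<nu>', f')" "nbr_node M (\<nu>, f) x = x'" "nbr M (\<nu>', f') = (\<nu>, f)"
      "nbr_node M (\<nu>', f') x' = x" "normal M \<nu>' f' x' = - normal M \<nu> f x"
    have ext: "ext_val M Y \<nu> f x = Y \<nu>' x'" "ext_val M Y \<nu>' f' x' = Y \<nu> x" for Y :: "nat \<Rightarrow> node \<Rightarrow> 'b"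
      by (simp_all add: ext_val_def glued)
    show "flux \<nu>' f' x' = - flux \<nu> f x"
      unfolding flux_def ext glued(9) viscous_density_antisymmetric[of "W \<nu>' x'"]
      using glued face_nodes_in_nodes adm
      by (subst advective_density_antisymmetric) (auto simp: g)
  qed
  finally show "\<exists>D\<le>0. ((\<lambda>s. total_entropy P N \<xi> M (U s)) has_real_derivative D) (at t within T)"
    using deriv by blast
qed

end
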